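(* Let $L|K$ be a finite field extension, $\omega$ a valuation on $L$ and $\nu$ its restriction to $K$. Then $\mathrm{gr}_\omega(\mathcal{O}_\omega)$ is finitely generated over $\mathrm{gr}_\nu(\mathcal{O}_\nu)$ if and only if $(\Gamma_\omega)_{\geq 0}$ is finitely generated over $(\Gamma_\nu)_{\geq 0}$.
   Context: $\mathcal{O}_\omega,\mathcal{O}_\nu$ are the valuation rings and $\Gamma_\omega\supseteq\Gamma_\nu$ the value groups (totally ordered abelian groups) of $\omega,\nu$; $(\Gamma)_{\geq0}=\{\gamma\in\Gamma\mid\gamma\ge0\}$. The graded algebra of $\omega$ is $$\mathrm{gr}_\omega(\mathcal{O}_\omega)=\bigoplus_{\gamma\in\Gamma_\omega}\{x\in\mathcal{O}_\omega\mid\omega(x)\ge\gamma\}/\{x\in\mathcal{O}_\omega\mid\omega(x)>\gamma\},$$ and $\mathrm{gr}_\nu(\mathcal{O}_\nu)$ is defined likewise with $\Gamma_\nu$, $\mathcal{O}_\nu$, $\nu$. There is a natural inclusion of graded domains $\mathrm{gr}_\nu(\mathcal{O}_\nu)\to\mathrm{gr}_\omega(\mathcal{O}_\omega)$, which is an integral extension; "finitely generated" for graded algebras means finitely generated as an algebra, equivalently (by integrality) as a module. If $S$ is a subsemigroup of an abelian semigroup $T$, then $T$ is finitely generated over $S$ (a finitely generated $S$-module; equivalently $S$ has finite index in $T$) if there exist finitely many $\gamma_1,\ldots,\gamma_t\in T$ with $T=\bigcup_{i=1}^t(\gamma_i+S)$. *)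

theory Defs
  imports "HOL-Algebra.Algebra" "HOL-Library.Extended"
begin

text \<open>Krull valuations of arbitrary rank, written additively. The type \<open>'g\<close> may be any totally
  ordered abelian group containing the value group; \<open>v\<close> need not be onto it.\<close>

definition valuation :: "('a, 'b) ring_scheme \<Rightarrow> ('a \<Rightarrow> 'g::linordered_ab_group_add extended) \<Rightarrow> bool"
  where "valuation F v \<longleftrightarrow>
    (\<forall>x\<in>carrier F. v x \<noteq> Minf) \<and>
    (\<forall>x\<in>carrier F. v x = Pinf \<longleftrightarrow> x = \<zero>\<^bsub>F\<^esub>) \<and>
    (\<forall>x\<in>carrier F. \<forall>y\<in>carrier F. v (x \<otimes>\<^bsub>F\<^esub> y) = v x + v y) \<and>
    (\<forall>x\<in>carrier F. \<forall>y\<in>carrier F. min (v x) (v y) \<le> v (x \<oplus>\<^bsub>F\<^esub> y))"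

definition value_group :: "('a, 'b) ring_scheme \<Rightarrow> ('a \<Rightarrow> 'g extended) \<Rightarrow> 'g set"
  where "value_group F v = {\<gamma>. \<exists>x\<in>carrier F. v x = Fin \<gamma>}"

definition valuation_ring ::
  "('a, 'b) ring_scheme \<Rightarrow> ('a \<Rightarrow> 'g::linordered_ab_group_add extended) \<Rightarrow> 'a set"
  where "valuation_ring F v = {x \<in> carrier F. 0 \<le> v x}"

definition filt_ge ::
  "('a, 'b) ring_scheme \<Rightarrow> ('a \<Rightarrow> 'g::linordered_ab_group_add extended) \<Rightarrow> 'g \<Rightarrow> 'a set"
  where "filt_ge F v \<gamma> = {x \<in> valuation_ring F v. Fin \<gamma> \<le> v x}"

definition filt_gt ::
  "('a, 'b) ring_scheme \<Rightarrow> ('a \<Rightarrow> 'g::linordered_ab_group_add extended) \<Rightarrow> 'g \<Rightarrow> 'a set"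
  where "filt_gt F v \<gamma> = {x \<in> valuation_ring F v. Fin \<gamma> < v x}"

text \<open>The additive group of the component of degree \<open>\<gamma>\<close>. It is trivial for \<open>\<gamma> < 0\<close>, since the
  filtration is taken inside the valuation ring.\<close>

definition gr_component ::
  "('a, 'b) ring_scheme \<Rightarrow> ('a \<Rightarrow> 'g::linordered_ab_group_add extended) \<Rightarrow> 'g \<Rightarrow> 'a set monoid"
  where "gr_component F v \<gamma> = (F\<lparr>carrier := filt_ge F v \<gamma>\<rparr>) A_Mod (filt_gt F v \<gamma>)"

definition gr_additive ::
  "('a, 'b) ring_scheme \<Rightarrow> ('a \<Rightarrow> 'g::linordered_ab_group_add extended) \<Rightarrow> ('g \<Rightarrow> 'a set) monoid"
  where "gr_additive F v = sum_group (value_group F v) (gr_component F v)"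

text \<open>The product is the bilinear extension of
  \<open>(x + filt_gt \<alpha>) (y + filt_gt \<beta>) = x y + filt_gt (\<alpha> + \<beta>)\<close>. The components are
  multiplicatively written monoids, so \<open>finprod\<close> is the sum in a component and its \<open>\<one>\<close> is the
  zero coset.\<close>

definition gr_mult ::
  "('a, 'b) ring_scheme \<Rightarrow> ('a \<Rightarrow> 'g::linordered_ab_group_add extended)
    \<Rightarrow> ('g \<Rightarrow> 'a set) \<Rightarrow> ('g \<Rightarrow> 'a set) \<Rightarrow> 'g \<Rightarrow> 'a set"
  where "gr_mult F v f g =
    (\<lambda>\<gamma>\<in>value_group F v.
      finprod (gr_component F v \<gamma>)
        (\<lambda>(\<alpha>, \<beta>). rcoset_mult F (filt_gt F v \<gamma>) (f \<alpha>) (g \<beta>))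
        {(\<alpha>, \<beta>). \<alpha> \<in> value_group F v \<and> \<beta> \<in> value_group F v \<and> \<alpha> + \<beta> = \<gamma> \<and>
          f \<alpha> \<noteq> \<one>\<^bsub>gr_component F v \<alpha>\<^esub> \<and> g \<beta> \<noteq> \<one>\<^bsub>gr_component F v \<beta>\<^esub>})"

definition gr_one ::
  "('a, 'b) ring_scheme \<Rightarrow> ('a \<Rightarrow> 'g::linordered_ab_group_add extended) \<Rightarrow> 'g \<Rightarrow> 'a set"
  where "gr_one F v =
    (\<lambda>\<gamma>\<in>value_group F v.
      if \<gamma> = 0 then filt_gt F v 0 +>\<^bsub>F\<^esub> \<one>\<^bsub>F\<^esub> else \<one>\<^bsub>gr_component F v \<gamma>\<^esub>)"

definition gr ::
  "('a, 'b) ring_scheme \<Rightarrow> ('a \<Rightarrow> 'g::linordered_ab_group_add extended) \<Rightarrow> ('g \<Rightarrow> 'a set) ring"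
  where "gr F v =
    \<lparr>carrier = carrier (gr_additive F v),
     monoid.mult = gr_mult F v,
     one = gr_one F v,
     ring.zero = \<one>\<^bsub>gr_additive F v\<^esub>,
     ring.add = monoid.mult (gr_additive F v)\<rparr>"

text \<open>The natural map from the graded algebra of \<open>\<nu>\<close> on a subfield \<open>K\<close> to that of \<open>\<omega>\<close> on \<open>L\<close>, sending
  the class of \<open>x\<close> modulo \<open>filt_gt K \<nu> \<gamma>\<close> to its class modulo \<open>filt_gt L \<omega> \<gamma>\<close>. Since all
  elements of a coset have the same image, the union below is a single coset.\<close>

definition gr_incl ::
  "('a, 'b) ring_scheme \<Rightarrow> ('a, 'b) ring_scheme
    \<Rightarrow> ('a \<Rightarrow> 'g::linordered_ab_group_add extended) \<Rightarrow> ('a \<Rightarrow> 'g extended)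
    \<Rightarrow> ('g \<Rightarrow> 'a set) \<Rightarrow> 'g \<Rightarrow> 'a set"
  where "gr_incl K L \<nu> \<omega> f =
    (\<lambda>\<gamma>\<in>value_group L \<omega>.
      if \<gamma> \<in> value_group K \<nu> then (\<Union>x\<in>f \<gamma>. filt_gt L \<omega> \<gamma> +>\<^bsub>L\<^esub> x)
      else \<one>\<^bsub>gr_component L \<omega> \<gamma>\<^esub>)"

text \<open>\<open>B\<close> is a finitely generated algebra over \<open>A\<close> along the homomorphism \<open>\<phi>\<close>.\<close>

definition fin_gen_algebra ::
  "('c \<Rightarrow> 'd) \<Rightarrow> ('c, 'e) ring_scheme \<Rightarrow> ('d, 'f) ring_scheme \<Rightarrow> bool"
  where "fin_gen_algebra \<phi> A B \<longleftrightarrow>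
    (\<exists>E. finite E \<and> E \<subseteq> carrier B \<and> generate_ring B (\<phi> ` carrier A \<union> E) = carrier B)"

definition nonneg_part :: "'g::linordered_ab_group_add set \<Rightarrow> 'g set"
  where "nonneg_part \<Gamma> = {\<gamma> \<in> \<Gamma>. 0 \<le> \<gamma>}"

definition fin_gen_semigroup :: "'g::ab_semigroup_add set \<Rightarrow> 'g set \<Rightarrow> bool"
  where "fin_gen_semigroup T S \<longleftrightarrow>
    (\<exists>E. finite E \<and> E \<subseteq> T \<and> T = (\<Union>\<gamma>\<in>E. (\<lambda>s. \<gamma> + s) ` S))"

end

theory Submission
  imports Defs
begin

text \<open>The support of an element of the graded algebra is contained in every submonoid of the value
  group that contains the supports of the generators. Since \<open>\<Gamma>\<^sub>\<omega> / \<Gamma>\<^sub>\<nu>\<close> is a torsion group (two of the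
  summands in a linear relation between the powers of an element have the same value), adjoining to
  \<open>(\<Gamma>\<^sub>\<nu>)\<^sub>\<ge>\<^sub>0\<close> the finitely many degrees that occur in a finite set of generators gives a finitely
  generated module over \<open>(\<Gamma>\<^sub>\<nu>)\<^sub>\<ge>\<^sub>0\<close>, and it must be all of \<open>(\<Gamma>\<^sub>\<omega>)\<^sub>\<ge>\<^sub>0\<close>.

  Conversely, if \<open>(\<Gamma>\<^sub>\<omega>)\<^sub>\<ge>\<^sub>0\<close> is generated by \<open>\<gamma>\<^sub>1, \<dots>, \<gamma>\<^sub>t\<close>, choose \<open>x\<^sub>i\<close> of value \<open>\<gamma>\<^sub>i\<close>, and lifts
  \<open>u\<^sub>j\<close> of a basis of the residue field extension, which is finite because elements with independent
  residues are independent over \<open>K\<close>. An element \<open>y\<close> of value \<open>\<gamma>\<^sub>i + \<nu> z\<close> is \<open>x\<^sub>i z\<close> times a unit, so the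
  initial forms of the \<open>x\<^sub>i\<close> and \<open>u\<^sub>j\<close> generate.\<close>

section \<open>Calculus of values in a field with a valuation\<close>

lemma Fin_add_less:
  fixes a b :: "'g::linordered_ab_group_add extended"
  assumes "Fin \<alpha> < a" "Fin \<beta> \<le> b"
  shows "Fin (\<alpha> + \<beta>) < a + b" "Fin (\<beta> + \<alpha>) < b + a"
  using assms by (cases a; cases b; auto simp: add_less_le_mono add_le_less_mono)+

locale valued_field = field F
  for F :: "('a, 'b) ring_scheme" (structure) +
  fixes v :: "'a \<Rightarrow> 'g::linordered_ab_group_add extended"
  assumes valuation: "valuation F v"
begin

lemma val_neq_Minf: "x \<in> carrier F \<Longrightarrow> v x \<noteq> Minf"
  and val_eq_Pinf_iff: "x \<in> carrier F \<Longrightarrow> v x = Pinf \<longleftrightarrow> x = \<zero>"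
  and val_mult: "x \<in> carrier F \<Longrightarrow> y \<in> carrier F \<Longrightarrow> v (x \<otimes> y) = v x + v y"
  and val_add: "x \<in> carrier F \<Longrightarrow> y \<in> carrier F \<Longrightarrow> min (v x) (v y) \<le> v (x \<oplus> y)"
  using valuation unfolding valuation_def by auto

lemma val_zero [simp]: "v \<zero> = Pinf"
  by (simp add: val_eq_Pinf_iff)

lemma val_finite:
  assumes "x \<in> carrier F" "x \<noteq> \<zero>"
  obtains g where "v x = Fin g"
  using assms val_neq_Minf val_eq_Pinf_iff by (cases "v x") auto

lemma val_one [simp]: "v \<one> = 0"
proof -
  obtain g where g: "v \<one> = Fin g"
    using val_finite[OF one_closed] by auto
  have "v \<one> = v \<one> + v \<one>"
    using val_mult[of \<one> \<one>] by simp
  then show ?thesis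
    using g by (simp add: zero_extended_def)
qed

text \<open>Since (-1)(-1) = 1, twice the value of -1 is 0, and an ordered group has no element of
  order two.\<close>

lemma val_uminus [simp]:
  assumes "x \<in> carrier F"
  shows "v (\<ominus> x) = v x"
proof -
  obtain g where g: "v (\<ominus> \<one>) = Fin g"
    using val_finite[of "\<ominus> \<one>"] by auto
  have "v \<one> = v (\<ominus> \<one>) + v (\<ominus> \<one>)"
    using val_mult[of "\<ominus> \<one>" "\<ominus> \<one>"] by (simp add: l_minus)
  then have "v (\<ominus> \<one>) = 0"
    using g by (simp add: zero_extended_def)
  moreover have "\<ominus> x = \<ominus> \<one> \<otimes> x"
    using assms by (simp add: l_minus)
  ultimately show ?thesis
    using assms by (simp add: val_mult)
qed

lemma val_add_ge:
  assumes "x \<in> carrier F" "y \<in> carrier F" "c \<le> v x" "c \<le> v y"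
  shows "c \<le> v (x \<oplus> y)"
  using val_add[of x y] assms by (meson min.boundedI order_trans)

lemma val_add_gt:
  assumes "x \<in> carrier F" "y \<in> carrier F" "c < v x" "c < v y"
  shows "c < v (x \<oplus> y)"
  using val_add[of x y] assms by (meson min_less_iff_conj less_le_trans)

lemma val_add_eq:
  assumes "x \<in> carrier F" "y \<in> carrier F" "v x < v y"
  shows "v (x \<oplus> y) = v x"
proof (rule antisym)
  show "v x \<le> v (x \<oplus> y)"
    using assms by (intro val_add_ge) auto
  \<comment> \<open>If the sum had larger value than \<open>x\<close>, both terms on the right would
    have value above that of \<open>x\<close>.\<close>
  have "x = (x \<oplus> y) \<oplus> \<ominus> y"
    using assms by (simp add: a_assoc r_neg)
  then have "min (v (x \<oplus> y)) (v y) \<le> v x"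
    using val_add[of "x \<oplus> y" "\<ominus> y"] assms by simp
  then show "v (x \<oplus> y) \<le> v x"
    using assms(3) by (auto simp: min_def split: if_splits)
qed

lemma val_inv:
  assumes "x \<in> carrier F" "v x = Fin g"
  shows "inv x \<in> carrier F" "x \<otimes> inv x = \<one>" "v (inv x) = Fin (- g)"
proof -
  have "x \<noteq> \<zero>"
    using assms by auto
  then have u: "x \<in> Units F"
    using assms field_Units by auto
  then show i: "inv x \<in> carrier F" and xi: "x \<otimes> inv x = \<one>"
    by auto
  have "v x + v (inv x) = 0"
    using val_mult[OF assms(1) i] xi by simp
  then show "v (inv x) = Fin (- g)"
    using assms(2) by (cases "v (inv x)") (auto simp: zero_extended_def eq_neg_iff_add_eq_0 add.commute)
qed

lemma value_group_closed:
  shows "0 \<in> value_group F v"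
    and "g \<in> value_group F v \<Longrightarrow> h \<in> value_group F v \<Longrightarrow> g + h \<in> value_group F v"
    and "g \<in> value_group F v \<Longrightarrow> - g \<in> value_group F v"
proof -
  show "0 \<in> value_group F v"
    unfolding value_group_def using val_one one_closed unfolding zero_extended_def by blast
  show "g + h \<in> value_group F v" if gh: "g \<in> value_group F v" "h \<in> value_group F v"
  proof -
    obtain x y where "x \<in> carrier F" "v x = Fin g" "y \<in> carrier F" "v y = Fin h"
      using gh unfolding value_group_def by auto
    then have "x \<otimes> y \<in> carrier F" "v (x \<otimes> y) = Fin (g + h)"
      by (simp_all add: val_mult)
    then show ?thesis
      unfolding value_group_def by blast
  qed
  show "- g \<in> value_group F v" if "g \<in> value_group F v"
    using that val_inv unfolding value_group_def by blast
qed

section \<open>The filtration and its graded components\<close>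

abbreviation "\<Gamma> \<equiv> value_group F v"
abbreviation "Fge \<equiv> filt_ge F v"
abbreviation "Fgt \<equiv> filt_gt F v"
abbreviation "Gr \<equiv> gr_component F v"

lemma mem_Fge: "x \<in> Fge \<gamma> \<longleftrightarrow> x \<in> carrier F \<and> 0 \<le> v x \<and> Fin \<gamma> \<le> v x"
  by (auto simp: filt_ge_def valuation_ring_def)

lemma mem_Fgt: "x \<in> Fgt \<gamma> \<longleftrightarrow> x \<in> carrier F \<and> 0 \<le> v x \<and> Fin \<gamma> < v x"
  by (auto simp: filt_gt_def valuation_ring_def)

lemma Fgt_subset_Fge: "Fgt \<gamma> \<subseteq> Fge \<gamma>"
  by (auto simp: mem_Fge mem_Fgt)

lemma Fge_carrier: "x \<in> Fge \<gamma> \<Longrightarrow> x \<in> carrier F"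
  by (simp add: mem_Fge)

lemma Fgt_carrier: "x \<in> Fgt \<gamma> \<Longrightarrow> x \<in> carrier F"
  by (simp add: mem_Fgt)

text \<open>Both steps are taken inside the valuation ring, so below degree zero each of them is the
  whole ring. Hence negative components vanish and supports are nonnegative.\<close>

lemma Fge_neg: "\<gamma> < 0 \<Longrightarrow> Fge \<gamma> = Fgt \<gamma>"
  using less_le_trans[of "Fin \<gamma>" "Fin 0"] by (fastforce simp: mem_Fge mem_Fgt zero_extended_def)

lemma subgroup_Fge: "subgroup (Fge \<gamma>) (add_monoid F)"
proof (rule add.subgroupI)
  have "\<zero> \<in> Fge \<gamma>"
    by (simp add: mem_Fge)
  then show "Fge \<gamma> \<noteq> {}"
    by blast
qed (auto simp: mem_Fge a_inv_def[symmetric] intro: val_add_ge)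

lemma subgroup_Fgt: "subgroup (Fgt \<gamma>) (add_monoid F)"
proof (rule add.subgroupI)
  have "\<zero> \<in> Fgt \<gamma>"
    by (simp add: mem_Fgt)
  then show "Fgt \<gamma> \<noteq> {}"
    by blast
qed (auto simp: mem_Fgt a_inv_def[symmetric] intro: val_add_ge val_add_gt)

interpretation Fgt: additive_subgroup "Fgt \<gamma>" F for \<gamma>
  by (rule additive_subgroup.intro[OF subgroup_Fgt])

interpretation Fge: additive_subgroup "Fge \<gamma>" F for \<gamma>
  by (rule additive_subgroup.intro[OF subgroup_Fge])

lemma zero_mem_filt [simp]: "\<zero> \<in> Fge \<gamma>" "\<zero> \<in> Fgt \<gamma>"
  by simp_all

lemma Fge_add: "x \<in> Fge \<gamma> \<Longrightarrow> y \<in> Fge \<gamma> \<Longrightarrow> x \<oplus> y \<in> Fge \<gamma>"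
  by simp

lemma mem_coset: "y \<in> Fgt \<gamma> +> x \<longleftrightarrow> (\<exists>h\<in>Fgt \<gamma>. y = h \<oplus> x)"
  by (auto simp: a_r_coset_def')

lemma coset_self: "x \<in> carrier F \<Longrightarrow> x \<in> Fgt \<gamma> +> x"
  by (auto simp: mem_coset intro!: bexI[of _ \<zero>])

lemma coset_repr: "x \<in> carrier F \<Longrightarrow> y \<in> Fgt \<gamma> +> x \<Longrightarrow> Fgt \<gamma> +> y = Fgt \<gamma> +> x"
  using add.repr_independence[OF _ _ subgroup_Fgt, of y \<gamma> x] by (simp add: a_r_coset_def)

lemma coset_eq_Fgt_iff:
  assumes "x \<in> carrier F"
  shows "Fgt \<gamma> +> x = Fgt \<gamma> \<longleftrightarrow> x \<in> Fgt \<gamma>"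
  using add.coset_join2[OF _ subgroup_Fgt, of x \<gamma>] coset_self[OF assms, of \<gamma>] assms
  by (auto simp: a_r_coset_def)

lemma comm_group_Fge: "comm_group ((add_monoid F)\<lparr>carrier := Fge \<gamma>\<rparr>)"
proof -
  interpret G: group "(add_monoid F)\<lparr>carrier := Fge \<gamma>\<rparr>"
    using subgroup.subgroup_is_group[OF subgroup_Fge add.is_group] .
  show ?thesis
    by (rule G.group_comm_groupI) (simp add: Fge_carrier a_comm)
qed

lemma subgroup_Fgt_Fge: "subgroup (Fgt \<gamma>) ((add_monoid F)\<lparr>carrier := Fge \<gamma>\<rparr>)"
  by (rule add.subgroup_incl[OF subgroup_Fgt subgroup_Fge Fgt_subset_Fge])

lemma component_eq: "Gr \<gamma> = (add_monoid F)\<lparr>carrier := Fge \<gamma>\<rparr> Mod Fgt \<gamma>"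
  by (simp add: gr_component_def A_FactGroup_def)

lemma comm_group_component: "comm_group (Gr \<gamma>)"
  unfolding component_eq by (rule comm_group.abelian_FactGroup[OF comm_group_Fge subgroup_Fgt_Fge])

lemma group_component: "group (Gr \<gamma>)"
  using comm_group_component comm_group.axioms(2) by blast

lemma component_one [simp]: "\<one>\<^bsub>Gr \<gamma>\<^esub> = Fgt \<gamma>"
  by (simp add: component_eq)

lemma component_carrier: "carrier (Gr \<gamma>) = {Fgt \<gamma> +> x | x. x \<in> Fge \<gamma>}"
  by (auto simp: component_eq carrier_FactGroup r_coset_def a_r_coset_def)

lemma component_mult:
  assumes "x \<in> Fge \<gamma>" "y \<in> Fge \<gamma>"
  shows "(Fgt \<gamma> +> x) \<otimes>\<^bsub>Gr \<gamma>\<^esub> (Fgt \<gamma> +> y) = Fgt \<gamma> +> (x \<oplus> y)"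
proof -
  interpret normal "Fgt \<gamma>" "(add_monoid F)\<lparr>carrier := Fge \<gamma>\<rparr>"
    using comm_group.normal_iff_subgroup[OF comm_group_Fge] subgroup_Fgt_Fge by blast
  show ?thesis
    using rcos_sum[of x y] assms
    by (simp add: component_eq a_r_coset_def r_coset_def)
qed

lemma component_neg: "\<gamma> < 0 \<Longrightarrow> A \<in> carrier (Gr \<gamma>) \<Longrightarrow> A = Fgt \<gamma>"
  unfolding component_carrier by (clarsimp simp only: Fge_neg coset_eq_Fgt_iff Fgt_carrier)

lemma Fge_mult:
  assumes "x \<in> Fge \<alpha>" "y \<in> Fge \<beta>"
  shows "x \<otimes> y \<in> Fge (\<alpha> + \<beta>)"
proof -
  have "0 + 0 \<le> v x + v y" "Fin \<alpha> + Fin \<beta> \<le> v x + v y"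
    using assms unfolding mem_Fge by (blast intro: add_mono)+
  then show ?thesis
    using assms by (auto simp: mem_Fge val_mult)
qed

lemma Fgt_mult:
  shows "x \<in> Fgt \<alpha> \<Longrightarrow> y \<in> Fge \<beta> \<Longrightarrow> x \<otimes> y \<in> Fgt (\<alpha> + \<beta>)"
    and "x \<in> Fge \<alpha> \<Longrightarrow> y \<in> Fgt \<beta> \<Longrightarrow> x \<otimes> y \<in> Fgt (\<alpha> + \<beta>)"
proof -
  assume x: "x \<in> Fgt \<alpha>" and y: "y \<in> Fge \<beta>"
  have "x \<otimes> y \<in> Fge (\<alpha> + \<beta>)"
    using x y Fgt_subset_Fge by (intro Fge_mult) auto
  moreover have "Fin (\<alpha> + \<beta>) < v (x \<otimes> y)"
    unfolding val_mult[OF Fgt_carrier[OF x] Fge_carrier[OF y]]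
    using x y unfolding mem_Fge mem_Fgt by (blast intro: Fin_add_less(1))
  ultimately show "x \<otimes> y \<in> Fgt (\<alpha> + \<beta>)"
    unfolding mem_Fge mem_Fgt by blast
next
  assume x: "x \<in> Fge \<alpha>" and y: "y \<in> Fgt \<beta>"
  have "x \<otimes> y \<in> Fge (\<alpha> + \<beta>)"
    using x y Fgt_subset_Fge by (intro Fge_mult) auto
  moreover have "Fin (\<alpha> + \<beta>) < v (x \<otimes> y)"
    unfolding val_mult[OF Fge_carrier[OF x] Fgt_carrier[OF y]]
    using x y unfolding mem_Fge mem_Fgt by (blast intro: Fin_add_less(2))
  ultimately show "x \<otimes> y \<in> Fgt (\<alpha> + \<beta>)"
    unfolding mem_Fge mem_Fgt by blast
qed

text \<open>\<open>rcoset_mult\<close> is a union over all pairs of representatives, so the content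
  is independence of the choice: (h + x) b = (h b + x k) + x y for b = k + y, and the bracket has
  value above \<alpha> + \<beta>.\<close>

lemma coset_mult:
  assumes x: "x \<in> Fge \<alpha>" and y: "y \<in> Fge \<beta>"
  shows "rcoset_mult F (Fgt (\<alpha> + \<beta>)) (Fgt \<alpha> +> x) (Fgt \<beta> +> y) = Fgt (\<alpha> + \<beta>) +> (x \<otimes> y)"
proof -
  have xy: "x \<in> carrier F" "y \<in> carrier F"
    using x y by (auto simp: Fge_carrier)
  have "Fgt (\<alpha> + \<beta>) +> (a \<otimes> b) = Fgt (\<alpha> + \<beta>) +> (x \<otimes> y)"
    if ab: "a \<in> Fgt \<alpha> +> x" "b \<in> Fgt \<beta> +> y" for a b
  proof -
    obtain h k where h: "h \<in> Fgt \<alpha>" "a = h \<oplus> x" and k: "k \<in> Fgt \<beta>" "b = k \<oplus> y"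
      using ab by (auto simp: mem_coset)
    have c: "h \<in> carrier F" "k \<in> carrier F"
      using h k by (auto simp: Fgt_carrier)
    have "b \<in> Fge \<beta>"
      using k y Fgt_subset_Fge by auto
    then have "h \<otimes> b \<in> Fgt (\<alpha> + \<beta>)" "x \<otimes> k \<in> Fgt (\<alpha> + \<beta>)"
      using Fgt_mult h k x by auto
    then have "h \<otimes> b \<oplus> x \<otimes> k \<in> Fgt (\<alpha> + \<beta>)"
      by simp
    moreover have "a \<otimes> b = (h \<otimes> b \<oplus> x \<otimes> k) \<oplus> x \<otimes> y"
      using h k c xy by (simp add: l_distr r_distr a_ac)
    ultimately have "a \<otimes> b \<in> Fgt (\<alpha> + \<beta>) +> (x \<otimes> y)"
      by (auto simp: mem_coset)
    then show ?thesis
      using coset_repr xy by blast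
  qed
  moreover have "x \<in> Fgt \<alpha> +> x" "y \<in> Fgt \<beta> +> y"
    using xy coset_self by auto
  ultimately show ?thesis
    unfolding rcoset_mult_def by blast
qed


section \<open>The graded algebra: supports, products, homogeneous elements\<close>

abbreviation supp :: "('g \<Rightarrow> 'a set) \<Rightarrow> 'g set"
  where "supp f \<equiv> {\<gamma> \<in> \<Gamma>. f \<gamma> \<noteq> Fgt \<gamma>}"

lemma carrier_gr: "carrier (gr F v) = {f \<in> \<Pi>\<^sub>E \<gamma>\<in>\<Gamma>. carrier (Gr \<gamma>). finite (supp f)}"
  by (simp add: gr_def gr_additive_def carrier_sum_group group_component)

lemma add_gr: "f \<oplus>\<^bsub>gr F v\<^esub> g = (\<lambda>\<gamma>\<in>\<Gamma>. f \<gamma> \<otimes>\<^bsub>Gr \<gamma>\<^esub> g \<gamma>)"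
  by (simp add: gr_def gr_additive_def)

lemma add_monoid_gr: "add_monoid (gr F v) = gr_additive F v"
  by (rule monoid.equality) (simp_all add: gr_def)

lemma group_gr: "group (add_monoid (gr F v))"
  unfolding add_monoid_gr gr_additive_def by (simp add: group_component)

lemma uminus_gr:
  assumes "f \<in> carrier (gr F v)"
  shows "\<ominus>\<^bsub>gr F v\<^esub> f = (\<lambda>\<gamma>\<in>\<Gamma>. inv\<^bsub>Gr \<gamma>\<^esub> (f \<gamma>))"
proof -
  have "f \<in> carrier (sum_group \<Gamma> Gr)"
    using assms by (simp add: gr_def gr_additive_def)
  then show ?thesis
    unfolding a_inv_def add_monoid_gr gr_additive_def by (simp add: group_component)
qed

lemma zero_gr: "\<zero>\<^bsub>gr F v\<^esub> = (\<lambda>\<gamma>\<in>\<Gamma>. Fgt \<gamma>)"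
  by (simp add: gr_def gr_additive_def)

lemma mult_gr: "f \<otimes>\<^bsub>gr F v\<^esub> g = (\<lambda>\<gamma>\<in>\<Gamma>.
  finprod (Gr \<gamma>) (\<lambda>(\<alpha>, \<beta>). rcoset_mult F (Fgt \<gamma>) (f \<alpha>) (g \<beta>))
    {(\<alpha>, \<beta>). \<alpha> \<in> supp f \<and> \<beta> \<in> supp g \<and> \<alpha> + \<beta> = \<gamma>})"
proof -
  have "{(\<alpha>, \<beta>). \<alpha> \<in> \<Gamma> \<and> \<beta> \<in> \<Gamma> \<and> \<alpha> + \<beta> = \<gamma> \<and> f \<alpha> \<noteq> Fgt \<alpha> \<and> g \<beta> \<noteq> Fgt \<beta>} =
    {(\<alpha>, \<beta>). \<alpha> \<in> supp f \<and> \<beta> \<in> supp g \<and> \<alpha> + \<beta> = \<gamma>}" for \<gamma>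
    by auto
  then show ?thesis
    by (simp add: gr_def gr_mult_def)
qed

lemma gr_component_rep:
  assumes "f \<in> carrier (gr F v)" "\<gamma> \<in> \<Gamma>"
  obtains x where "x \<in> Fge \<gamma>" "f \<gamma> = Fgt \<gamma> +> x"
  using assms by (auto simp: carrier_gr component_carrier PiE_iff)

lemma supp_nonneg: "f \<in> carrier (gr F v) \<Longrightarrow> supp f \<subseteq> nonneg_part \<Gamma>"
  using component_neg by (force simp: carrier_gr nonneg_part_def PiE_iff not_le[symmetric])

lemma supp_add: "supp (f \<oplus>\<^bsub>gr F v\<^esub> g) \<subseteq> supp f \<union> supp g"
proof -
  have "Fgt \<gamma> \<otimes>\<^bsub>Gr \<gamma>\<^esub> Fgt \<gamma> = Fgt \<gamma>" for \<gamma>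
    using monoid.l_one[OF group.is_monoid[OF group_component[of \<gamma>]]
        monoid.one_closed[OF group.is_monoid[OF group_component[of \<gamma>]]]] by simp
  then show ?thesis
    by (auto simp: add_gr)
qed

lemma supp_uminus:
  assumes "f \<in> carrier (gr F v)"
  shows "supp (\<ominus>\<^bsub>gr F v\<^esub> f) \<subseteq> supp f"
  using monoid.inv_one[OF group.is_monoid[OF group_component]] by (auto simp: uminus_gr[OF assms])

text \<open>Each component of a product is a sum over pairs of support degrees adding up to
  \<gamma>. If there is no such pair, the empty sum is the zero coset
  \<open>Fgt \<gamma>\<close>.\<close>

lemma supp_mult:
  assumes "\<gamma> \<in> supp (f \<otimes>\<^bsub>gr F v\<^esub> g)"
  obtains \<alpha> \<beta> where "\<alpha> \<in> supp f" "\<beta> \<in> supp g" "\<gamma> = \<alpha> + \<beta>"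
proof -
  interpret G: comm_group "Gr \<gamma>"
    by (rule comm_group_component)
  have "{(\<alpha>, \<beta>). \<alpha> \<in> supp f \<and> \<beta> \<in> supp g \<and> \<alpha> + \<beta> = \<gamma>} \<noteq> {}"
  proof
    assume e: "{(\<alpha>, \<beta>). \<alpha> \<in> supp f \<and> \<beta> \<in> supp g \<and> \<alpha> + \<beta> = \<gamma>} = {}"
    have "(f \<otimes>\<^bsub>gr F v\<^esub> g) \<gamma> = Fgt \<gamma>" if "\<gamma> \<in> \<Gamma>"
      using that unfolding mult_gr restrict_apply' [OF that] e by simp
    then show False
      using assms by simp
  qed
  then show ?thesis
    using that by blast
qed

lemma rcoset_mult_closed:
  assumes "f \<in> carrier (gr F v)" "g \<in> carrier (gr F v)" "\<alpha> \<in> \<Gamma>" "\<beta> \<in> \<Gamma>"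
  shows "rcoset_mult F (Fgt (\<alpha> + \<beta>)) (f \<alpha>) (g \<beta>) \<in> carrier (Gr (\<alpha> + \<beta>))"
proof -
  obtain x y where "x \<in> Fge \<alpha>" "f \<alpha> = Fgt \<alpha> +> x" "y \<in> Fge \<beta>" "g \<beta> = Fgt \<beta> +> y"
    using gr_component_rep assms by metis
  then show ?thesis
    using coset_mult[of x \<alpha> y \<beta>] Fge_mult[of x \<alpha> y \<beta>] by (auto simp: component_carrier)
qed

lemma mult_gr_closed:
  assumes f: "f \<in> carrier (gr F v)" and g: "g \<in> carrier (gr F v)"
  shows "f \<otimes>\<^bsub>gr F v\<^esub> g \<in> carrier (gr F v)"
proof -
  have "(f \<otimes>\<^bsub>gr F v\<^esub> g) \<gamma> \<in> carrier (Gr \<gamma>)" if "\<gamma> \<in> \<Gamma>" for \<gamma>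
  proof -
    interpret G: comm_group "Gr \<gamma>"
      by (rule comm_group_component)
    show ?thesis
      using that rcoset_mult_closed[OF f g] by (auto simp: mult_gr intro!: G.finprod_closed)
  qed
  moreover have "f \<otimes>\<^bsub>gr F v\<^esub> g \<in> extensional \<Gamma>"
    by (simp add: mult_gr)
  moreover have "finite (supp (f \<otimes>\<^bsub>gr F v\<^esub> g))"
  proof (rule finite_subset)
    show "supp (f \<otimes>\<^bsub>gr F v\<^esub> g) \<subseteq> (\<lambda>(\<alpha>, \<beta>). \<alpha> + \<beta>) ` (supp f \<times> supp g)"
    proof
      fix \<gamma> assume "\<gamma> \<in> supp (f \<otimes>\<^bsub>gr F v\<^esub> g)"
      then obtain \<alpha> \<beta> where "\<alpha> \<in> supp f" "\<beta> \<in> supp g" "\<gamma> = \<alpha> + \<beta>"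
        by (rule supp_mult)
      then show "\<gamma> \<in> (\<lambda>(\<alpha>, \<beta>). \<alpha> + \<beta>) ` (supp f \<times> supp g)"
        by blast
    qed
    show "finite ((\<lambda>(\<alpha>, \<beta>). \<alpha> + \<beta>) ` (supp f \<times> supp g))"
      using f g by (simp add: carrier_gr)
  qed
  ultimately show ?thesis
    by (auto simp: carrier_gr PiE_iff)
qed

text \<open>For \<open>x\<close> of value exactly \<gamma> this is the initial form of
  \<open>x\<close>. It is zero when \<open>x\<close> lies in \<open>Fgt \<gamma>\<close>, and also
  when \<gamma> is not in the value group.\<close>

definition homog :: "'g \<Rightarrow> 'a \<Rightarrow> 'g \<Rightarrow> 'a set"
  where "homog \<gamma> x = (\<lambda>\<delta>\<in>\<Gamma>. if \<delta> = \<gamma> then Fgt \<gamma> +> x else Fgt \<delta>)"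

lemma Fgt_closed: "Fgt \<gamma> \<in> carrier (Gr \<gamma>)"
  using monoid.one_closed[OF group.is_monoid[OF group_component[of \<gamma>]]] by simp

lemma coset_closed: "x \<in> Fge \<gamma> \<Longrightarrow> Fgt \<gamma> +> x \<in> carrier (Gr \<gamma>)"
  by (auto simp: component_carrier)

lemma homog_closed:
  assumes "x \<in> Fge \<gamma>"
  shows "homog \<gamma> x \<in> carrier (gr F v)"
proof -
  have "finite (supp (homog \<gamma> x))"
    by (rule finite_subset[of _ "{\<gamma>}"]) (auto simp: homog_def)
  then show ?thesis
    using assms by (auto simp: carrier_gr homog_def Fgt_closed coset_closed PiE_iff)
qed

lemma supp_homog: "x \<in> carrier F \<Longrightarrow> supp (homog \<gamma> x) = (if \<gamma> \<in> \<Gamma> \<and> x \<notin> Fgt \<gamma> then {\<gamma>} else {})"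
  by (auto simp: homog_def coset_eq_Fgt_iff)

lemma homog_add:
  assumes "x \<in> Fge \<gamma>" "y \<in> Fge \<gamma>"
  shows "homog \<gamma> x \<oplus>\<^bsub>gr F v\<^esub> homog \<gamma> y = homog \<gamma> (x \<oplus> y)"
proof -
  have "Fgt \<gamma> \<otimes>\<^bsub>Gr \<gamma>\<^esub> Fgt \<gamma> = Fgt \<gamma>" for \<gamma>
    using monoid.l_one[OF group.is_monoid[OF group_component] Fgt_closed] by simp
  then show ?thesis
    using assms by (auto simp: add_gr homog_def component_mult intro!: restrict_ext)
qed

lemma homog_eq_zero:
  assumes "x \<in> Fgt \<gamma>"
  shows "homog \<gamma> x = \<zero>\<^bsub>gr F v\<^esub>"
proof -
  have "Fgt \<gamma> +> x = Fgt \<gamma>"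
    using assms by (simp only: coset_eq_Fgt_iff Fgt_carrier)
  then show ?thesis
    unfolding homog_def zero_gr by (intro restrict_ext) simp
qed

lemma one_gr: "\<one>\<^bsub>gr F v\<^esub> = homog 0 \<one>"
  by (auto simp: gr_def gr_one_def homog_def intro!: restrict_ext)

lemma homog_mult:
  assumes x: "x \<in> Fge \<alpha>" and y: "y \<in> Fge \<beta>" and \<alpha>: "\<alpha> \<in> \<Gamma>" and \<beta>: "\<beta> \<in> \<Gamma>"
  shows "homog \<alpha> x \<otimes>\<^bsub>gr F v\<^esub> homog \<beta> y = homog (\<alpha> + \<beta>) (x \<otimes> y)"
\<comment> \<open>The sum defining the product runs over pairs of nonzero components only. If a
  factor vanishes, there is no pair and both sides are zero; otherwise the single pair (\<alpha>,
  \<beta>) remains.\<close>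
proof (cases "x \<in> Fgt \<alpha> \<or> y \<in> Fgt \<beta>")
  case True
  then have "x \<otimes> y \<in> Fgt (\<alpha> + \<beta>)"
    using Fgt_mult x y by blast
  then have "homog (\<alpha> + \<beta>) (x \<otimes> y) = \<zero>\<^bsub>gr F v\<^esub>"
    by (rule homog_eq_zero)
  moreover have "(homog \<alpha> x \<otimes>\<^bsub>gr F v\<^esub> homog \<beta> y) \<gamma> = Fgt \<gamma>" if "\<gamma> \<in> \<Gamma>" for \<gamma>
  proof (rule ccontr)
    assume "(homog \<alpha> x \<otimes>\<^bsub>gr F v\<^esub> homog \<beta> y) \<gamma> \<noteq> Fgt \<gamma>"
    with that have "\<gamma> \<in> supp (homog \<alpha> x \<otimes>\<^bsub>gr F v\<^esub> homog \<beta> y)"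
      by simp
    then obtain \<alpha>' \<beta>' where "\<alpha>' \<in> supp (homog \<alpha> x)" "\<beta>' \<in> supp (homog \<beta> y)"
      by (rule supp_mult)
    then show False
      using True x y by (auto simp only: supp_homog Fge_carrier split: if_splits)
  qed
  ultimately show ?thesis
    by (auto simp: zero_gr mult_gr intro!: ext)
next
  case False
  have c: "x \<in> carrier F" "y \<in> carrier F"
    using x y by (auto simp: Fge_carrier)
  have "(homog \<alpha> x \<otimes>\<^bsub>gr F v\<^esub> homog \<beta> y) \<gamma> = homog (\<alpha> + \<beta>) (x \<otimes> y) \<gamma>" if \<gamma>: "\<gamma> \<in> \<Gamma>" for \<gamma>
  proof -
    interpret G: comm_group "Gr \<gamma>"
      by (rule comm_group_component)
    have S: "{(\<alpha>', \<beta>'). \<alpha>' \<in> supp (homog \<alpha> x) \<and> \<beta>' \<in> supp (homog \<beta> y) \<and> \<alpha>' + \<beta>' = \<gamma>} =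
      (if \<alpha> + \<beta> = \<gamma> then {(\<alpha>, \<beta>)} else {})"
      unfolding supp_homog[OF c(1)] supp_homog[OF c(2)] using False \<alpha> \<beta> by auto
    have m: "rcoset_mult F (Fgt (\<alpha> + \<beta>)) (homog \<alpha> x \<alpha>) (homog \<beta> y \<beta>) = Fgt (\<alpha> + \<beta>) +> (x \<otimes> y)"
      using \<alpha> \<beta> coset_mult[OF x y] by (simp add: homog_def)
    have "(homog \<alpha> x \<otimes>\<^bsub>gr F v\<^esub> homog \<beta> y) \<gamma> = finprod (Gr \<gamma>)
      (\<lambda>(\<alpha>', \<beta>'). rcoset_mult F (Fgt \<gamma>) (homog \<alpha> x \<alpha>') (homog \<beta> y \<beta>')) (if \<alpha> + \<beta> = \<gamma> then {(\<alpha>, \<beta>)} else {})"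
      unfolding mult_gr S[symmetric] using \<gamma> by simp
    also have "\<dots> = homog (\<alpha> + \<beta>) (x \<otimes> y) \<gamma>"
    proof (cases "\<alpha> + \<beta> = \<gamma>")
      case True
      have "Fgt \<gamma> +> (x \<otimes> y) \<in> carrier (Gr \<gamma>)"
        using True Fge_mult[OF x y] by (auto intro: coset_closed)
      then show ?thesis
        using G.finprod_insert[of "{}" "(\<alpha>, \<beta>)"
            "\<lambda>(\<alpha>', \<beta>'). rcoset_mult F (Fgt \<gamma>) (homog \<alpha> x \<alpha>') (homog \<beta> y \<beta>')"]
          G.r_one m \<gamma> unfolding True by (simp add: homog_def)
    next
      case False
      then show ?thesis
        using \<gamma> by (auto simp: homog_def)
    qed
    finally show ?thesis .
  qed
  moreover have "homog \<alpha> x \<otimes>\<^bsub>gr F v\<^esub> homog \<beta> y \<in> extensional \<Gamma>" "homog (\<alpha> + \<beta>) (x \<otimes> y) \<in> extensional \<Gamma>"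
    by (simp_all add: mult_gr homog_def)
  ultimately show ?thesis
    by (blast intro: extensionalityI)
qed

text \<open>An element is the finite sum of its homogeneous components. The induction runs over a
  finite set containing the support and splits off one component at a time.\<close>

lemma gr_induct:
  assumes f: "f \<in> carrier (gr F v)"
    and homog: "\<And>\<gamma> x. \<gamma> \<in> \<Gamma> \<Longrightarrow> x \<in> Fge \<gamma> \<Longrightarrow> P (homog \<gamma> x)"
    and add: "\<And>f g. P f \<Longrightarrow> P g \<Longrightarrow> P (f \<oplus>\<^bsub>gr F v\<^esub> g)"
  shows "P f"
proof -
  have "P f" if "finite S" "f \<in> carrier (gr F v)" "supp f \<subseteq> S" for S f
    using that
  proof (induction S arbitrary: f rule: finite_induct)
    case empty
    then have "f = (\<lambda>\<gamma>\<in>\<Gamma>. Fgt \<gamma>)"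
      by (auto simp: carrier_gr PiE_iff intro!: extensionalityI[of _ \<Gamma>])
    \<comment> \<open>Zero counts as a homogeneous element, so the rule has no separate case for
      it.\<close>
    then have "f = homog 0 \<zero>"
      by (simp add: homog_eq_zero zero_gr)
    then show ?case
      using homog[of 0 \<zero>] value_group_closed(1) by simp
  next
    case (insert \<gamma> S)
    show ?case
    proof (cases "\<gamma> \<in> \<Gamma>")
      case True
      then obtain x where x: "x \<in> Fge \<gamma>" "f \<gamma> = Fgt \<gamma> +> x"
        using gr_component_rep insert.prems by blast
      \<comment> \<open>Deleting the component of degree \<gamma> leaves an element supported in
        \<open>S\<close>.\<close>
      define g where "g = f(\<gamma> := Fgt \<gamma>)"
      have "supp g \<subseteq> supp f"
        by (auto simp: g_def)
      then have "g \<in> carrier (gr F v)"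
        using insert.prems True finite_subset[of "supp g" "supp f"]
        by (auto simp: carrier_gr g_def Fgt_closed PiE_iff extensional_def)
      moreover have "supp g \<subseteq> S"
        using insert.prems by (auto simp: g_def)
      ultimately have "P g"
        using insert.IH by blast
      moreover have "f = g \<oplus>\<^bsub>gr F v\<^esub> homog \<gamma> x"
      proof (rule extensionalityI[of _ \<Gamma>])
        show "f \<in> extensional \<Gamma>" "g \<oplus>\<^bsub>gr F v\<^esub> homog \<gamma> x \<in> extensional \<Gamma>"
          using insert.prems by (auto simp: carrier_gr add_gr PiE_iff)
        fix \<delta> assume \<delta>: "\<delta> \<in> \<Gamma>"
        interpret G: group "Gr \<delta>"
          by (rule group_component)
        have "f \<delta> \<in> carrier (Gr \<delta>)"
          using insert.prems \<delta> by (auto simp: carrier_gr)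
        then show "f \<delta> = (g \<oplus>\<^bsub>gr F v\<^esub> homog \<gamma> x) \<delta>"
          using \<delta> x G.l_one[of "f \<delta>"] G.r_one[of "f \<delta>"] by (auto simp: add_gr g_def homog_def)
      qed
      ultimately show ?thesis
        using add homog True x by metis
    next
      case False
      then show ?thesis
        using insert by auto
    qed
  qed
  then show ?thesis
    using f by (auto simp: carrier_gr)
qed

lemma generate_ring_gr_closed:
  assumes "H \<subseteq> carrier (gr F v)" "f \<in> generate_ring (gr F v) H"
  shows "f \<in> carrier (gr F v)"
  using assms(2)
proof induction
  case one
  show ?case
    unfolding one_gr by (rule homog_closed) (simp add: mem_Fge zero_extended_def[symmetric])
next
  case (a_inv h)
  then show ?case
    using group.inv_closed[OF group_gr, of h] by (simp add: a_inv_def)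
next
  case (eng_add f g)
  then show ?case
    using monoid.m_closed[OF group.is_monoid[OF group_gr], of f g] by simp
qed (use assms(1) mult_gr_closed in auto)

end

section \<open>Adjoining torsion elements to a submonoid\<close>

primrec nmul :: "nat \<Rightarrow> 'g::comm_monoid_add \<Rightarrow> 'g"
  where "nmul 0 g = 0"
  | "nmul (Suc n) g = g + nmul n g"

lemma nmul_add: "nmul (m + n) g = nmul m g + nmul n g"
  by (induction m) (simp_all add: add.assoc)

lemma nmul_mult: "nmul (m * n) g = nmul m (nmul n g)"
  by (induction m) (simp_all add: nmul_add)

lemma nmul_closed:
  assumes "0 \<in> P" "\<And>x y. x \<in> P \<Longrightarrow> y \<in> P \<Longrightarrow> x + y \<in> P" "g \<in> P"
  shows "nmul n g \<in> P"
  using assms by (induction n) auto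

text \<open>The elements of \<open>D\<close> are adjoined one after another. As some positive
  multiple of \<open>d\<close> lies in \<open>P\<close>, only finitely many multiples of
  \<open>d\<close> are needed as new translates. \<open>W\<close> is carried along in two guises, as
  a finite union of translates of \<open>P\<close> and as a set closed under addition, because the
  induction step uses both.\<close>

lemma fin_gen_torsion_submonoid:
  fixes P T D :: "'g::comm_monoid_add set"
  assumes P: "0 \<in> P" "\<And>x y. x \<in> P \<Longrightarrow> y \<in> P \<Longrightarrow> x + y \<in> P"
    and T: "\<And>x y. x \<in> T \<Longrightarrow> y \<in> T \<Longrightarrow> x + y \<in> T" and "P \<subseteq> T"
    and D: "finite D" "D \<subseteq> T" "\<And>d. d \<in> D \<Longrightarrow> \<exists>m>0. nmul m d \<in> P"
  shows "\<exists>E W. finite E \<and> E \<subseteq> T \<and> W = (\<Union>e\<in>E. (\<lambda>p. e + p) ` P) \<and> P \<union> D \<subseteq> W \<and>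
    (\<forall>x\<in>W. \<forall>y\<in>W. x + y \<in> W)"
  using D
proof (induction D rule: finite_induct)
  case empty
  show ?case
    using P \<open>P \<subseteq> T\<close> by (intro exI[of _ "{0}"] exI[of _ P]) auto
next
  case (insert d D)
  then obtain E W where E: "finite E" "E \<subseteq> T" and W: "W = (\<Union>e\<in>E. (\<lambda>p. e + p) ` P)"
    and sub: "P \<union> D \<subseteq> W" and add: "\<forall>x\<in>W. \<forall>y\<in>W. x + y \<in> W"
    by (metis insert_subset insertCI)
  obtain m where m: "m > 0" "nmul m d \<in> P"
    using insert.prems by blast
  \<comment> \<open>Multiples of \<open>d\<close> below the exponent \<open>m\<close> suffice as
    translates, whereas \<open>W'\<close> admits all multiples and is therefore visibly closed under
    addition. The two descriptions agree by division with remainder.\<close>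
  define E' where "E' = (\<lambda>(e, r). e + nmul r d) ` (E \<times> {..<m})"
  define W' where "W' = {w + nmul n d | w n. w \<in> W}"
  have W': "W' = (\<Union>e\<in>E'. (\<lambda>p. e + p) ` P)"
  proof
    show "W' \<subseteq> (\<Union>e\<in>E'. (\<lambda>p. e + p) ` P)"
    proof
      fix x assume "x \<in> W'"
      then obtain e p n where e: "e \<in> E" "p \<in> P" and x: "x = e + p + nmul n d"
        by (auto simp: W'_def W)
      \<comment> \<open>The full blocks of \<open>m\<close> copies of \<open>d\<close> are absorbed
        into the summand from \<open>P\<close>; the remainder goes to the translate.\<close>
      define q where "q = p + nmul (n div m) (nmul m d)"
      have "nmul n d = nmul (n div m) (nmul m d) + nmul (n mod m) d"
        by (simp add: nmul_mult[symmetric] nmul_add[symmetric])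
      then have "x = (e + nmul (n mod m) d) + q"
        unfolding x q_def by (simp add: add_ac)
      moreover have "q \<in> P"
        unfolding q_def by (intro P(2) e(2) nmul_closed P(1) m(2)) auto
      moreover have "e + nmul (n mod m) d \<in> E'"
        using e m by (auto simp: E'_def intro!: image_eqI[of _ _ "(e, n mod m)"])
      ultimately show "x \<in> (\<Union>e\<in>E'. (\<lambda>p. e + p) ` P)"
        by blast
    qed
    show "(\<Union>e\<in>E'. (\<lambda>p. e + p) ` P) \<subseteq> W'"
    proof
      fix x assume "x \<in> (\<Union>e\<in>E'. (\<lambda>p. e + p) ` P)"
      then obtain e r p where "e \<in> E" "p \<in> P" "x = (e + nmul r d) + p"
        by (auto simp: E'_def)
      moreover from this have "e + p \<in> W" "x = (e + p) + nmul r d"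
        by (auto simp: W add_ac)
      ultimately show "x \<in> W'"
        unfolding W'_def by blast
    qed
  qed
  have WW': "w + nmul n d \<in> W'" if "w \<in> W" for w n
    using that by (auto simp: W'_def)
  have "W \<subseteq> W'"
    using WW'[of _ 0] by auto
  moreover have "d \<in> W'"
    using WW'[of 0 1] P(1) sub by auto
  moreover have "x + y \<in> W'" if xy: "x \<in> W'" "y \<in> W'" for x y
  proof -
    obtain w n w' n' where "w \<in> W" "w' \<in> W" "x = w + nmul n d" "y = w' + nmul n' d"
      using xy by (auto simp: W'_def)
    moreover from this have "x + y = (w + w') + nmul (n + n') d"
      by (simp add: nmul_add add_ac)
    ultimately show ?thesis
      using WW' add by auto
  qed
  moreover have "finite E'"
    using E by (simp add: E'_def)
  moreover have "E' \<subseteq> T"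
  proof
    fix x assume "x \<in> E'"
    then obtain e r where x: "e \<in> E" "x = e + nmul r d"
      by (auto simp: E'_def)
    have "d \<in> T"
      using insert.prems by blast
    then have "nmul r d \<in> T"
      using P(1) \<open>P \<subseteq> T\<close> T by (intro nmul_closed) auto
    then show "x \<in> T"
      using x E T by auto
  qed
  ultimately show ?case
    using W' sub by (intro exI[of _ E'] exI[of _ W']) auto
qed

section \<open>Finite extensions and the natural map of graded algebras\<close>

locale valued_extension = valued_field L \<omega>
  for L :: "('a, 'b) ring_scheme" (structure)
    and \<omega> :: "'a \<Rightarrow> 'g::linordered_ab_group_add extended" +
  fixes K :: "'a set" and \<nu> :: "'a \<Rightarrow> 'g extended"
  assumes subfield: "subfield K L"
    and finite_ext: "finite_dimension K (carrier L)"
    and restriction: "x \<in> K \<Longrightarrow> \<nu> x = \<omega> x"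
begin

abbreviation "LK \<equiv> L\<lparr>carrier := K\<rparr>"

lemma K_carrier: "x \<in> K \<Longrightarrow> x \<in> carrier L"
  using subfieldE(3)[OF subfield] by blast

lemma valued_field_K: "valued_field LK \<nu>"
proof -
  interpret K: field LK
    using subfield_iff(2)[OF subfield] .
  have "valuation LK \<nu>"
    unfolding valuation_def using K.m_closed K.a_closed
    by (auto simp: restriction K_carrier val_neq_Minf val_eq_Pinf_iff val_mult val_add)
  then show ?thesis
    by unfold_locales
qed

sublocale K: valued_field LK \<nu>
  by (rule valued_field_K)

lemma K_mult_closed: "x \<in> K \<Longrightarrow> y \<in> K \<Longrightarrow> x \<otimes> y \<in> K"
  using K.m_closed by auto

lemma K_zero_one: "\<zero> \<in> K" "\<one> \<in> K"
  using K.zero_closed K.one_closed by auto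

lemma K_inv:
  assumes "x \<in> K" "\<omega> x = Fin g"
  shows "inv x \<in> K"
proof -
  have "x \<noteq> \<zero>"
    using assms by auto
  then show ?thesis
    using assms subfield_m_inv(1)[OF subfield, of x] by simp
qed

lemma value_group_K: "K.\<Gamma> \<subseteq> \<Gamma>"
  using K_carrier restriction by (fastforce simp: value_group_def)

lemma K_Fge: "x \<in> K.Fge \<gamma> \<longleftrightarrow> x \<in> K \<and> x \<in> Fge \<gamma>"
  using restriction K_carrier by (auto simp: K.mem_Fge mem_Fge)

lemma K_Fgt: "x \<in> K.Fgt \<gamma> \<longleftrightarrow> x \<in> K \<and> x \<in> Fgt \<gamma>"
  using restriction K_carrier by (auto simp: K.mem_Fgt mem_Fgt)

abbreviation "\<phi> \<equiv> gr_incl LK L \<nu> \<omega>"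

text \<open>Elements of one coset of \<open>K.Fgt \<gamma>\<close> differ by elements of
  \<open>Fgt \<gamma>\<close>, so all cosets in the union defining \<open>gr_incl\<close>
  coincide.\<close>

lemma incl_apply:
  assumes \<gamma>: "\<gamma> \<in> K.\<Gamma>" and x: "x \<in> K.Fge \<gamma>" and f: "f \<gamma> = K.Fgt \<gamma> +>\<^bsub>LK\<^esub> x"
  shows "\<phi> f \<gamma> = Fgt \<gamma> +> x"
proof -
  have xc: "x \<in> carrier L" "x \<in> K"
    using x by (auto simp: K_Fge K_carrier)
  have "x \<in> f \<gamma>"
    using K.coset_self[of x \<gamma>] f xc by simp
  moreover have "Fgt \<gamma> +> y = Fgt \<gamma> +> x" if y: "y \<in> f \<gamma>" for y
  proof (rule coset_repr[OF xc(1)])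
    show "y \<in> Fgt \<gamma> +> x"
      using y f by (auto simp: K.mem_coset mem_coset K_Fgt)
  qed
  ultimately have "(\<Union>y\<in>f \<gamma>. Fgt \<gamma> +> y) = Fgt \<gamma> +> x"
    by blast
  then show ?thesis
    using \<gamma> subsetD[OF value_group_K \<gamma>] by (simp add: gr_incl_def)
qed

lemma incl_apply_outside: "\<gamma> \<in> \<Gamma> \<Longrightarrow> \<gamma> \<notin> K.\<Gamma> \<Longrightarrow> \<phi> f \<gamma> = Fgt \<gamma>"
  by (simp add: gr_incl_def)

text \<open>A zero component has its representatives in \<open>K.Fgt\<close>, hence in
  \<open>Fgt\<close>, so its image is zero again. With \<open>K.supp_nonneg\<close> this places the
  supports of all images in the nonnegative part of the small value group.\<close>

lemma supp_incl:
  assumes f: "f \<in> carrier (gr LK \<nu>)"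
  shows "supp (\<phi> f) \<subseteq> K.supp f"
proof
  fix \<gamma> assume \<gamma>: "\<gamma> \<in> supp (\<phi> f)"
  then have \<gamma>K: "\<gamma> \<in> K.\<Gamma>"
    using incl_apply_outside by auto
  then obtain x where x: "x \<in> K.Fge \<gamma>" "f \<gamma> = K.Fgt \<gamma> +>\<^bsub>LK\<^esub> x"
    using K.gr_component_rep f by blast
  then have xK: "x \<in> K" "x \<in> carrier L"
    by (auto simp: K_Fge K_carrier)
  have "Fgt \<gamma> +> x \<noteq> Fgt \<gamma>"
    using \<gamma> incl_apply[where f = f, OF \<gamma>K x] by simp
  then have "x \<notin> K.Fgt \<gamma>"
    using coset_eq_Fgt_iff xK K_Fgt by blast
  then have "f \<gamma> \<noteq> K.Fgt \<gamma>"
    using K.coset_eq_Fgt_iff[of x \<gamma>] x xK by simp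
  then show "\<gamma> \<in> K.supp f"
    using \<gamma>K by simp
qed

lemma incl_closed:
  assumes f: "f \<in> carrier (gr LK \<nu>)"
  shows "\<phi> f \<in> carrier (gr L \<omega>)"
proof -
  have "\<phi> f \<gamma> \<in> carrier (Gr \<gamma>)" if "\<gamma> \<in> \<Gamma>" for \<gamma>
  proof (cases "\<gamma> \<in> K.\<Gamma>")
    case True
    then obtain x where x: "x \<in> K.Fge \<gamma>" "f \<gamma> = K.Fgt \<gamma> +>\<^bsub>LK\<^esub> x"
      using K.gr_component_rep f by blast
    then have "x \<in> Fge \<gamma>"
      using K_Fge by blast
    then show ?thesis
      using incl_apply[where f = f, OF True x] by (auto intro: coset_closed)
  next
    case False
    then show ?thesis
      using incl_apply_outside that Fgt_closed by auto
  qed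
  moreover have "finite (supp (\<phi> f))"
    using f supp_incl[OF f] K.carrier_gr finite_subset by blast
  moreover have "\<phi> f \<in> extensional \<Gamma>"
    by (simp add: gr_incl_def)
  ultimately show ?thesis
    by (auto simp: carrier_gr PiE_iff)
qed

lemma incl_homog:
  assumes \<gamma>: "\<gamma> \<in> K.\<Gamma>" and x: "x \<in> K.Fge \<gamma>"
  shows "\<phi> (K.homog \<gamma> x) = homog \<gamma> x"
proof (rule extensionalityI[of _ \<Gamma>])
  show "\<phi> (K.homog \<gamma> x) \<in> extensional \<Gamma>" "homog \<gamma> x \<in> extensional \<Gamma>"
    by (simp_all add: gr_incl_def homog_def)
  fix \<delta> assume \<delta>: "\<delta> \<in> \<Gamma>"
  \<comment> \<open>Writing the zero coset as the coset of the element zero lets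
    \<open>incl_apply\<close> handle the vanishing components too.\<close>
  have z: "K.Fgt \<delta> = K.Fgt \<delta> +>\<^bsub>LK\<^esub> \<zero>" "Fgt \<delta> +> \<zero> = Fgt \<delta>"
    using K.coset_eq_Fgt_iff[of \<zero> \<delta>] K.zero_mem_filt(2)[of \<delta>] coset_eq_Fgt_iff[of \<zero> \<delta>] K_zero_one
    by simp_all
  show "\<phi> (K.homog \<gamma> x) \<delta> = homog \<gamma> x \<delta>"
  proof (cases "\<delta> = \<gamma>")
    case True
    have "K.homog \<gamma> x \<gamma> = K.Fgt \<gamma> +>\<^bsub>LK\<^esub> x"
      using \<gamma> by (simp add: K.homog_def)
    then show ?thesis
      using True \<delta> incl_apply[OF \<gamma> x] by (simp add: homog_def)
  next
    case False
    show ?thesis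
    proof (cases "\<delta> \<in> K.\<Gamma>")
      case True
      then have "K.homog \<gamma> x \<delta> = K.Fgt \<delta> +>\<^bsub>LK\<^esub> \<zero>"
        using False z by (simp add: K.homog_def)
      then have "\<phi> (K.homog \<gamma> x) \<delta> = Fgt \<delta> +> \<zero>"
        using True K.zero_mem_filt by (intro incl_apply) auto
      then show ?thesis
        using False \<delta> z by (simp add: homog_def)
    qed (use False \<delta> in \<open>simp add: incl_apply_outside homog_def\<close>)
  qed
qed

section \<open>The value group of the extension is torsion over that of the subfield\<close>

text \<open>If the nonzero terms have pairwise distinct values, the term of least value determines
  the value of the sum. In the induction the new term is compared with the rest, whose value is that
  of one of its terms: equality yields two terms of equal value, and otherwise the smaller value
  prevails.\<close>

lemma combine_valuation:
  assumes "length Ks = length Us" "set Ks \<subseteq> K" "set Us \<subseteq> carrier L - {\<zero>}"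
  shows "(\<exists>i j. i < j \<and> j < length Us \<and> Ks ! i \<noteq> \<zero> \<and> Ks ! j \<noteq> \<zero> \<and>
      \<omega> (Ks ! i \<otimes> Us ! i) = \<omega> (Ks ! j \<otimes> Us ! j)) \<or>
    set Ks \<subseteq> {\<zero>} \<and> combine Ks Us = \<zero> \<or>
    (\<exists>i<length Us. Ks ! i \<noteq> \<zero> \<and> \<omega> (combine Ks Us) = \<omega> (Ks ! i \<otimes> Us ! i))"
  using assms
proof (induction Ks Us rule: list_induct2)
  case (Cons k Ks u Us)
  have c: "k \<in> carrier L" "u \<in> carrier L" "combine Ks Us \<in> carrier L"
    using Cons.prems K_carrier by (auto intro!: combine_in_carrier)
  consider (pair) i j where "i < j" "j < length Us" "Ks ! i \<noteq> \<zero>" "Ks ! j \<noteq> \<zero>"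
      "\<omega> (Ks ! i \<otimes> Us ! i) = \<omega> (Ks ! j \<otimes> Us ! j)"
    | (zero) "set Ks \<subseteq> {\<zero>}" "combine Ks Us = \<zero>"
    | (one) i where "i < length Us" "Ks ! i \<noteq> \<zero>" "\<omega> (combine Ks Us) = \<omega> (Ks ! i \<otimes> Us ! i)"
    using Cons by auto
  then show ?case
  proof cases
    case pair
    then show ?thesis
      by (intro disjI1 exI[of _ "Suc i"] exI[of _ "Suc j"]) auto
  next
    case zero
    then show ?thesis
      using c by (cases "k = \<zero>") (auto intro!: exI[of _ 0])
  next
    case one
    show ?thesis
    proof (cases "k = \<zero>")
      case True
      then show ?thesis
        using one c by (intro disjI2 exI[of _ "Suc i"]) auto
    next
      case False
      consider "\<omega> (k \<otimes> u) = \<omega> (combine Ks Us)" | "\<omega> (k \<otimes> u) < \<omega> (combine Ks Us)"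
        | "\<omega> (combine Ks Us) < \<omega> (k \<otimes> u)"
        by fastforce
      then show ?thesis
      proof cases
        case 1
        then show ?thesis
          using one False by (intro disjI1 exI[of _ 0] exI[of _ "Suc i"]) auto
      next
        case 2
        then have "\<omega> (k \<otimes> u \<oplus> combine Ks Us) = \<omega> (k \<otimes> u)"
          using c by (intro val_add_eq) auto
        then show ?thesis
          using False by (intro disjI2 exI[of _ 0]) auto
      next
        case 3
        then have "\<omega> (combine Ks Us \<oplus> k \<otimes> u) = \<omega> (combine Ks Us)"
          using c by (intro val_add_eq) auto
        then show ?thesis
          using one c by (intro disjI2 exI[of _ "Suc i"]) (auto simp: a_comm)
      qed
    qed
  qed
qed auto

lemma val_pow:
  assumes "x \<in> carrier L" "\<omega> x = Fin \<gamma>"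
  shows "\<omega> (x [^] n) = Fin (nmul n \<gamma>)"
proof (induction n)
  case (Suc n)
  then show ?case
    using assms by (simp add: val_mult add.commute)
qed (simp add: zero_extended_def)

lemma value_group_torsion:
  assumes "\<gamma> \<in> \<Gamma>"
  shows "\<exists>m>0. nmul m \<gamma> \<in> K.\<Gamma>"
proof -
  obtain x where x: "x \<in> carrier L" "\<omega> x = Fin \<gamma>"
    using assms by (auto simp: value_group_def)
  obtain n where n: "dimension n K (carrier L)"
    using finite_ext by (auto simp: finite_dimension_def)
  \<comment> \<open>These are n + 1 powers of \<open>x\<close>, one more than the dimension, so they
    are dependent.\<close>
  define Us where "Us = map (\<lambda>i. x [^] i) [0..<Suc n]"
  have len: "length Us = Suc n" and nth: "\<And>i. i < Suc n \<Longrightarrow> Us ! i = x [^] i"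
    by (simp_all add: Us_def del: upt_Suc)
  have pow0: "x [^] i \<noteq> \<zero>" for i :: nat
    using val_pow[OF x, of i] by auto
  then have Us: "set Us \<subseteq> carrier L - {\<zero>}"
    using x by (auto simp: Us_def)
  have "dependent K Us"
    using independent_length_le_dimension[OF subfield n, of Us] len Us by fastforce
  then obtain Ks where Ks: "length Ks = length Us" "combine Ks Us = \<zero>" "set Ks \<subseteq> K" "set Ks \<noteq> {\<zero>}"
    using dependent_imp_non_trivial_combine[OF subfield, of Us] Us by blast
  have "Ks \<noteq> []"
    using Ks len by auto
  \<comment> \<open>The relation only says that the set of coefficients is not {0}; the empty set
    has to be excluded through the length.\<close>
  then have ne: "\<not> set Ks \<subseteq> {\<zero>}"
    using Ks(4) by (metis set_empty subset_singletonD)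
  have prod: "\<exists>a. a \<in> K.\<Gamma> \<and> \<omega> (Ks ! i \<otimes> Us ! i) = Fin (a + nmul i \<gamma>)" if i: "i < Suc n" "Ks ! i \<noteq> \<zero>" for i
  proof -
    have k: "Ks ! i \<in> K"
      using i Ks len by (metis nth_mem subsetD)
    then obtain a where a: "\<omega> (Ks ! i) = Fin a"
      using val_finite[of "Ks ! i"] K_carrier i by auto
    then have "a \<in> K.\<Gamma>"
      using k restriction by (auto simp: value_group_def)
    moreover have "\<omega> (Ks ! i \<otimes> Us ! i) = Fin (a + nmul i \<gamma>)"
      using nth i a val_pow[OF x] k K_carrier x by (simp add: val_mult)
    ultimately show ?thesis
      by blast
  qed
  \<comment> \<open>The combination is zero and has value \<open>Pinf\<close>, while every term with
    nonzero coefficient has finite value. So two terms must share their value.\<close>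
  have "\<not> (\<exists>i<length Us. Ks ! i \<noteq> \<zero> \<and> \<omega> (combine Ks Us) = \<omega> (Ks ! i \<otimes> Us ! i))"
    using prod len Ks(2) by force
  then obtain i j where ij: "i < j" "j < Suc n" "Ks ! i \<noteq> \<zero>" "Ks ! j \<noteq> \<zero>"
      "\<omega> (Ks ! i \<otimes> Us ! i) = \<omega> (Ks ! j \<otimes> Us ! j)"
    using combine_valuation[OF Ks(1,3) Us] ne len by auto
  obtain a b where ab: "a \<in> K.\<Gamma>" "b \<in> K.\<Gamma>" "a + nmul i \<gamma> = b + nmul j \<gamma>"
    using prod[of i] prod[of j] ij by fastforce
  \<comment> \<open>Cancelling i copies of \<gamma> in a + i \<gamma> = b + j \<gamma> leaves a
    positive multiple of \<gamma> equal to a - b.\<close>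
  have "nmul j \<gamma> = nmul i \<gamma> + nmul (j - i) \<gamma>"
    using ij by (simp add: nmul_add[symmetric])
  then have "nmul (j - i) \<gamma> = a + - b"
    using ab(3) by (simp add: algebra_simps)
  then have "nmul (j - i) \<gamma> \<in> K.\<Gamma>"
    using K.value_group_closed(2)[OF ab(1) K.value_group_closed(3)[OF ab(2)]] by (simp only:)
  then show ?thesis
    using ij by (intro exI[of _ "j - i"]) auto
qed

section \<open>From algebra generators to semigroup generators\<close>

lemma nonneg_part_closed:
  "0 \<in> nonneg_part \<Gamma>" "\<gamma> \<in> nonneg_part \<Gamma> \<Longrightarrow> \<delta> \<in> nonneg_part \<Gamma> \<Longrightarrow> \<gamma> + \<delta> \<in> nonneg_part \<Gamma>"
  "0 \<in> nonneg_part K.\<Gamma>" "\<gamma> \<in> nonneg_part K.\<Gamma> \<Longrightarrow> \<delta> \<in> nonneg_part K.\<Gamma> \<Longrightarrow> \<gamma> + \<delta> \<in> nonneg_part K.\<Gamma>"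
  "nonneg_part K.\<Gamma> \<subseteq> nonneg_part \<Gamma>"
  using value_group_closed K.value_group_closed value_group_K by (auto simp: nonneg_part_def)

lemma nmul_nonneg: "0 \<le> g \<Longrightarrow> 0 \<le> nmul n (g :: 'g)"
  by (induction n) auto

text \<open>Having support in the submonoid \<open>W\<close> survives every operation of
  \<open>generate_ring\<close>: one lives in degree 0, negation creates no new degrees, sums stay in
  the union of the supports, and products stay in the set of sums of degrees.\<close>

lemma supp_generate_ring:
  assumes H: "H \<subseteq> carrier (gr L \<omega>)" and W: "0 \<in> W" "\<And>x y. x \<in> W \<Longrightarrow> y \<in> W \<Longrightarrow> x + y \<in> W"
    and HW: "\<And>h. h \<in> H \<Longrightarrow> supp h \<subseteq> W"
    and f: "f \<in> generate_ring (gr L \<omega>) H"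
  shows "supp f \<subseteq> W"
  using f
proof induction
  case one
  then show ?case
    unfolding one_gr supp_homog[OF one_closed] using W by simp
next
  case (incl h)
  then show ?case
    using HW by simp
next
  case (a_inv h)
  then show ?case
    using subset_trans[OF supp_uminus[OF generate_ring_gr_closed[OF H a_inv.hyps]] a_inv.IH] by simp
next
  case (eng_add f g)
  then show ?case
    using supp_add[of f g] by (meson Un_least subset_trans)
next
  case (eng_mult f g)
  show ?case
  proof
    fix \<gamma> assume "\<gamma> \<in> supp (f \<otimes>\<^bsub>gr L \<omega>\<^esub> g)"
    then obtain \<alpha> \<beta> where "\<alpha> \<in> supp f" "\<beta> \<in> supp g" "\<gamma> = \<alpha> + \<beta>"
      by (rule supp_mult)
    then show "\<gamma> \<in> W"
      using eng_mult.IH W(2) by blast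
  qed
qed

theorem fin_gen_semigroup_if_fin_gen_algebra:
  assumes "fin_gen_algebra \<phi> (gr LK \<nu>) (gr L \<omega>)"
  shows "fin_gen_semigroup (nonneg_part \<Gamma>) (nonneg_part K.\<Gamma>)"
proof -
  let ?T = "nonneg_part \<Gamma>" and ?P = "nonneg_part K.\<Gamma>"
  obtain G where G: "finite G" "G \<subseteq> carrier (gr L \<omega>)"
    and gen: "generate_ring (gr L \<omega>) (\<phi> ` carrier (gr LK \<nu>) \<union> G) = carrier (gr L \<omega>)"
    using assms unfolding fin_gen_algebra_def by blast
  define D where "D = (\<Union>f\<in>G. supp f)"
  have "finite D"
    using G by (auto simp: D_def carrier_gr)
  moreover have DT: "D \<subseteq> ?T"
    unfolding D_def using G supp_nonneg by blast
  \<comment> \<open>Degrees of generators are nonnegative, so the multiple that falls into the small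
    value group is nonnegative as well.\<close>
  moreover have "\<exists>m>0. nmul m d \<in> ?P" if "d \<in> D" for d
    using that DT value_group_torsion[of d] nmul_nonneg[of d] by (auto simp: nonneg_part_def)
  ultimately have "\<exists>E W. finite E \<and> E \<subseteq> ?T \<and> W = (\<Union>e\<in>E. (\<lambda>p. e + p) ` ?P) \<and> ?P \<union> D \<subseteq> W \<and>
    (\<forall>x\<in>W. \<forall>y\<in>W. x + y \<in> W)"
    using nonneg_part_closed by (intro fin_gen_torsion_submonoid) auto
  then obtain E W where E: "finite E" "E \<subseteq> ?T" and W: "W = (\<Union>e\<in>E. (\<lambda>p. e + p) ` ?P)"
    and sub: "?P \<union> D \<subseteq> W" and add': "\<forall>x\<in>W. \<forall>y\<in>W. x + y \<in> W"
    by (elim exE conjE)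
  have add: "x + y \<in> W" if "x \<in> W" "y \<in> W" for x y
    using add' that by simp
  have "?T \<subseteq> W"
  proof
    \<comment> \<open>The initial form of an element of value \<gamma> is a test element: its
      support is exactly {\<gamma>}, and it lies in the generated ring, so \<gamma> must be in
      \<open>W\<close>.\<close>
    fix \<gamma> assume \<gamma>: "\<gamma> \<in> ?T"
    then obtain x where x: "x \<in> carrier L" "\<omega> x = Fin \<gamma>" and \<gamma>': "\<gamma> \<in> \<Gamma>" "0 \<le> \<gamma>"
      by (auto simp: nonneg_part_def value_group_def)
    then have "homog \<gamma> x \<in> carrier (gr L \<omega>)"
      by (intro homog_closed) (simp add: mem_Fge zero_extended_def)
    then have g: "homog \<gamma> x \<in> generate_ring (gr L \<omega>) (\<phi> ` carrier (gr LK \<nu>) \<union> G)"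
      using gen by simp
    have "supp (homog \<gamma> x) \<subseteq> W"
    proof (rule supp_generate_ring[OF _ _ add _ g])
      show "\<phi> ` carrier (gr LK \<nu>) \<union> G \<subseteq> carrier (gr L \<omega>)"
        using G incl_closed by auto
      show "0 \<in> W"
        using sub nonneg_part_closed(3) by blast
      show "supp h \<subseteq> W" if h: "h \<in> \<phi> ` carrier (gr LK \<nu>) \<union> G" for h
      proof (cases "h \<in> G")
        case True
        then show ?thesis
          using sub unfolding D_def by blast
      next
        case False
        then obtain f where f: "f \<in> carrier (gr LK \<nu>)" "h = \<phi> f"
          using h by blast
        have "supp h \<subseteq> ?P"
          using supp_incl[OF f(1)] K.supp_nonneg[OF f(1)] unfolding f(2) by (rule subset_trans)
        then show ?thesis
          using sub by blast
      qed
    qed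
    moreover have "x \<notin> Fgt \<gamma>"
      using x by (simp add: mem_Fgt)
    ultimately show "\<gamma> \<in> W"
      unfolding supp_homog[OF x(1)] using \<gamma>' by simp
  qed
  moreover have "W \<subseteq> ?T"
    unfolding W using E nonneg_part_closed by blast
  ultimately have "?T = W"
    by simp
  then show ?thesis
    unfolding fin_gen_semigroup_def W using E by blast
qed

section \<open>Lifting a basis of the residue field extension\<close>

text \<open>The elements of the list lie in the valuation ring and their residues are linearly independent
  over the residue field of \<open>\<nu>\<close>; stated without the residue fields.\<close>

definition residue_independent :: "'a list \<Rightarrow> bool"
  where "residue_independent Us \<longleftrightarrow> set Us \<subseteq> carrier L \<and> (\<forall>u\<in>set Us. 0 \<le> \<omega> u) \<and>
    (\<forall>Ks. length Ks = length Us \<longrightarrow> set Ks \<subseteq> K \<longrightarrow> (\<forall>k\<in>set Ks. 0 \<le> \<omega> k) \<longrightarrow>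
      0 < \<omega> (combine Ks Us) \<longrightarrow> (\<forall>k\<in>set Ks. 0 < \<omega> k))"

lemma residue_independentD:
  assumes "residue_independent Us" "length Ks = length Us" "set Ks \<subseteq> K"
    and "\<And>k. k \<in> set Ks \<Longrightarrow> 0 \<le> \<omega> k" "0 < \<omega> (combine Ks Us)" "k \<in> set Ks"
  shows "0 < \<omega> k"
  using assms by (simp add: residue_independent_def)

text \<open>Dividing a nontrivial relation over \<open>K\<close> by a coefficient of least value
  makes all coefficients integral and one of them equal to 1. This contradicts independence of the
  residues.\<close>

lemma residue_independent_imp_independent:
  assumes U: "residue_independent Us"
  shows "independent K Us"
proof (rule ccontr)
  have Us: "set Us \<subseteq> carrier L"
    using U by (simp add: residue_independent_def)
  assume "\<not> independent K Us"
  then obtain Ks where Ks: "length Ks = length Us" "combine Ks Us = \<zero>" "set Ks \<subseteq> K" "set Ks \<noteq> {\<zero>}"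
    using dependent_imp_non_trivial_combine[OF subfield Us] by blast
  have "Ks \<noteq> []"
    using Ks \<open>\<not> independent K Us\<close> by auto
  then have "Min (\<omega> ` set Ks) \<in> \<omega> ` set Ks"
    by (intro Min_in) auto
  then obtain k0 where k0: "k0 \<in> set Ks" "\<omega> k0 = Min (\<omega> ` set Ks)"
    by auto
  then have min: "\<omega> k0 \<le> \<omega> k" if "k \<in> set Ks" for k
    using that by simp
  have "\<not> set Ks \<subseteq> {\<zero>}"
    using Ks(4) \<open>Ks \<noteq> []\<close> by (metis set_empty subset_singletonD)
  then obtain k1 where k1: "k1 \<in> set Ks" "k1 \<noteq> \<zero>"
    by blast
  have k0K: "k0 \<in> K" "k0 \<in> carrier L"
    using k0 Ks K_carrier by auto
  \<comment> \<open>Some coefficient is nonzero, so the least value is finite and \<open>k0\<close>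
    is invertible.\<close>
  have "\<omega> k1 \<noteq> Pinf"
    using k1 Ks K_carrier val_eq_Pinf_iff by blast
  then have "\<omega> k0 \<noteq> Pinf"
    using min[OF k1(1)] by auto
  then obtain g where g: "\<omega> k0 = Fin g"
    using val_neq_Minf[OF k0K(2)] by (cases "\<omega> k0") auto
  note i = val_inv[OF k0K(2) g] K_inv[OF k0K(1) g]
  let ?Ks = "map ((\<otimes>) (inv k0)) Ks"
  have KsL: "set Ks \<subseteq> carrier L"
    using Ks K_carrier by auto
  have "combine ?Ks Us = \<zero>"
    using combine_r_distr[OF KsL Us i(1)] Ks(2) i(1) by simp
  then have zero: "0 < \<omega> (combine ?Ks Us)"
    by (simp add: zero_extended_def)
  have nonneg: "0 \<le> \<omega> k" if k: "k \<in> set ?Ks" for k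
  proof -
    obtain j where j: "j \<in> set Ks" "k = inv k0 \<otimes> j"
      using k by auto
    then have "\<omega> k = Fin (- g) + \<omega> j"
      using i KsL by (auto simp: val_mult)
    then show ?thesis
      using min[OF j(1)] unfolding g by (cases "\<omega> j") (simp_all add: zero_extended_def)
  qed
  have sub: "set ?Ks \<subseteq> K"
    using Ks i K_mult_closed by auto
  have "0 < \<omega> k" if "k \<in> set ?Ks" for k
    using residue_independentD[OF U _ sub nonneg zero that] Ks(1) by simp
  then have "0 < \<omega> (inv k0 \<otimes> k0)"
    using k0 by auto
  then show False
    using i k0K by (simp add: m_comm)
qed

lemma residue_independent_Nil: "residue_independent []"
  by (simp add: residue_independent_def)

text \<open>Independence over \<open>K\<close> bounds the length by the dimension of the extension,
  so a list of greatest length exists. By \<open>residue_spanning\<close> its residues form a basis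
  of the residue field extension.\<close>

lemma maximal_residue_independent:
  obtains Us where "residue_independent Us" "\<And>y. \<not> residue_independent (y # Us)"
proof -
  obtain n where n: "dimension n K (carrier L)"
    using finite_ext by (auto simp: finite_dimension_def)
  have "length Us < Suc n" if "residue_independent Us" for Us
    using independent_length_le_dimension[OF subfield n residue_independent_imp_independent[OF that]]
      that by (simp add: residue_independent_def)
  then have "\<exists>Us. residue_independent Us \<and> (\<forall>Vs. residue_independent Vs \<longrightarrow> length Vs \<le> length Us)"
    by (intro ex_has_greatest_nat[of residue_independent "[]" length "Suc n"] residue_independent_Nil) simp
  then obtain Us where "residue_independent Us" "\<forall>Vs. residue_independent Vs \<longrightarrow> length Vs \<le> length Us"
    by blast
  then show ?thesis
    using that[of Us] by fastforce
qed

text \<open>A failure of independence for \<open>y # Us\<close> is an integral relation of positive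
  value with some coefficient of value 0. Independence of \<open>Us\<close> forces the coefficient
  of \<open>y\<close> to be a unit, so the relation can be solved for \<open>y\<close> modulo
  elements of positive value.\<close>

lemma residue_spanning:
  assumes U: "residue_independent Us" and max: "\<not> residue_independent (y # Us)"
    and y: "y \<in> carrier L" "0 \<le> \<omega> y"
  obtains Ks where "length Ks = length Us" "set Ks \<subseteq> K" "\<And>k. k \<in> set Ks \<Longrightarrow> 0 \<le> \<omega> k"
    "0 < \<omega> (y \<ominus> combine Ks Us)"
proof -
  have Us: "set Us \<subseteq> carrier L" "\<forall>u\<in>set Us. 0 \<le> \<omega> u"
    using U by (auto simp: residue_independent_def)
  obtain Js where Js: "length Js = length (y # Us)" "set Js \<subseteq> K" "\<forall>k\<in>set Js. 0 \<le> \<omega> k"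
      "0 < \<omega> (combine Js (y # Us))" "\<not> (\<forall>k\<in>set Js. 0 < \<omega> k)"
    using max Us y unfolding residue_independent_def by auto
  then obtain k Ks where JsC: "Js = k # Ks"
    by (cases Js) auto
  define c where "c = combine Ks Us"
  have Ks: "length Ks = length Us" "set Ks \<subseteq> K" "\<forall>k\<in>set Ks. 0 \<le> \<omega> k" and k: "k \<in> K" "0 \<le> \<omega> k"
    and pos: "0 < \<omega> (k \<otimes> y \<oplus> c)"
    using Js by (auto simp: JsC c_def)
  have KsL: "set Ks \<subseteq> carrier L"
    using Ks K_carrier by auto
  have c: "c \<in> carrier L" "k \<in> carrier L"
    using KsL Us k K_carrier by (auto simp: c_def)
  have "\<not> 0 < \<omega> k"
  proof
    \<comment> \<open>Then \<open>k \<otimes> y\<close> has positive value, hence so has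
      \<open>c\<close>. Independence of \<open>Us\<close> makes all of \<open>Ks\<close> positive,
      so no coefficient in \<open>Js\<close> would have value 0.\<close>
    assume k0: "0 < \<omega> k"
    have "0 + 0 < \<omega> k + \<omega> y"
      using k0 y by (cases "\<omega> k"; cases "\<omega> y") (auto simp: zero_extended_def add_pos_nonneg)
    then have "0 < \<omega> (\<ominus> (k \<otimes> y))"
      using c y by (simp add: val_mult)
    then have "0 < \<omega> (\<ominus> (k \<otimes> y) \<oplus> (k \<otimes> y \<oplus> c))"
      using pos c y by (simp only: val_add_gt a_inv_closed m_closed a_closed)
    also have "\<ominus> (k \<otimes> y) \<oplus> (k \<otimes> y \<oplus> c) = c"
      using c y by (simp add: r_neg1)
    finally have "\<forall>k\<in>set Ks. 0 < \<omega> k"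
      using U Ks by (simp add: residue_independent_def c_def)
    then show False
      using Js(5) k0 JsC by simp
  qed
  then have "\<omega> k = Fin 0"
    using k by (simp add: zero_extended_def)
  note i = val_inv[OF c(2) this] K_inv[OF k(1) this]
  \<comment> \<open>Multiplying the relation by the inverse of \<open>k\<close> gives
    \<open>y\<close> plus the inverse of \<open>k\<close> times \<open>c\<close>; the sign in
    \<open>l\<close> turns this into a difference.\<close>
  define l where "l = \<ominus> (inv k)"
  have l: "l \<in> carrier L" "l \<in> K" "\<omega> l = 0"
    using i K.a_inv_closed[of "inv k"] subringE(5)[OF subfieldE(1)[OF subfield]]
    by (simp_all add: l_def zero_extended_def)
  let ?Ks = "map ((\<otimes>) l) Ks"
  have comb: "combine ?Ks Us = l \<otimes> c"
    using combine_r_distr[OF KsL Us(1) l(1)] by (simp add: c_def)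
  show ?thesis
  proof (rule that[of ?Ks])
    show "length ?Ks = length Us" "set ?Ks \<subseteq> K"
      using Ks l K_mult_closed by auto
    show "0 \<le> \<omega> j" if "j \<in> set ?Ks" for j
      using that Ks l KsL by (auto simp: val_mult)
    have "inv k \<otimes> (k \<otimes> y \<oplus> c) = y \<ominus> combine ?Ks Us"
      using i c y unfolding comb
      by (simp add: l_def r_distr m_assoc[symmetric] m_comm[of "inv k" k] l_minus minus_eq)
    moreover have "\<omega> (inv k \<otimes> (k \<otimes> y \<oplus> c)) = \<omega> (k \<otimes> y \<oplus> c)"
      using i c y by (simp add: val_mult zero_extended_def[symmetric])
    ultimately show "0 < \<omega> (y \<ominus> combine ?Ks Us)"
      using pos by simp
  qed
qed

section \<open>From semigroup generators to algebra generators\<close>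

lemma homog_cong:
  assumes "x \<in> carrier L" "y \<in> carrier L" "x \<ominus> y \<in> Fgt \<gamma>"
  shows "homog \<gamma> x = homog \<gamma> y"
proof -
  have "x = (x \<ominus> y) \<oplus> y"
    using assms by (simp add: minus_eq a_assoc l_neg)
  then have "x \<in> Fgt \<gamma> +> y"
    using assms(3) unfolding mem_coset by blast
  then have "Fgt \<gamma> +> x = Fgt \<gamma> +> y"
    by (rule coset_repr[OF assms(2)])
  then show ?thesis
    by (simp only: homog_def)
qed

text \<open>In degree 0, \<open>homog\<close> respects sums and products of integral elements, so
  the form of a combination can be computed inside \<open>R\<close>, which stands for the generated
  ring. Membership in \<open>Fge 0\<close> is proved alongside because \<open>homog_add\<close> asks
  for it.\<close>

lemma homog_combine_mem:
  assumes R: "\<And>f g. f \<in> R \<Longrightarrow> g \<in> R \<Longrightarrow> f \<oplus>\<^bsub>gr L \<omega>\<^esub> g \<in> R"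
      "\<And>f g. f \<in> R \<Longrightarrow> g \<in> R \<Longrightarrow> f \<otimes>\<^bsub>gr L \<omega>\<^esub> g \<in> R"
    and K: "\<And>k. k \<in> K \<Longrightarrow> 0 \<le> \<omega> k \<Longrightarrow> homog 0 k \<in> R"
    and "length Ks = length Us" "set Ks \<subseteq> K" "\<forall>k\<in>set Ks. 0 \<le> \<omega> k"
    and "set Us \<subseteq> carrier L" "\<forall>u\<in>set Us. 0 \<le> \<omega> u" "homog 0 ` set Us \<subseteq> R"
  shows "combine Ks Us \<in> Fge 0 \<and> homog 0 (combine Ks Us) \<in> R"
  using assms(4-)
proof (induction Ks Us rule: list_induct2)
  case Nil
  then show ?case
    using K[of \<zero>] K_zero_one by simp
next
  case (Cons k Ks u Us)
  then have IH: "combine Ks Us \<in> Fge 0" "homog 0 (combine Ks Us) \<in> R"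
    by auto
  have ku: "k \<in> Fge 0" "u \<in> Fge 0"
    using Cons.prems K_carrier by (auto simp: mem_Fge zero_extended_def)
  have kuF: "k \<otimes> u \<in> Fge 0"
    using Fge_mult[OF ku] by simp
  have "homog 0 k \<in> R" "homog 0 u \<in> R"
    using Cons.prems K by auto
  then have "homog 0 k \<otimes>\<^bsub>gr L \<omega>\<^esub> homog 0 u \<oplus>\<^bsub>gr L \<omega>\<^esub> homog 0 (combine Ks Us) \<in> R"
    using R IH by blast
  then show ?case
    using IH ku kuF homog_mult[OF ku] homog_add[OF kuF IH(1)] Fge_add[OF kuF IH(1)] value_group_closed(1)
    by simp
qed

theorem fin_gen_algebra_if_fin_gen_semigroup:
  assumes "fin_gen_semigroup (nonneg_part \<Gamma>) (nonneg_part K.\<Gamma>)"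
  shows "fin_gen_algebra \<phi> (gr LK \<nu>) (gr L \<omega>)"
proof -
  obtain E where E: "finite E" "E \<subseteq> nonneg_part \<Gamma>"
    and gen: "nonneg_part \<Gamma> = (\<Union>e\<in>E. (\<lambda>p. e + p) ` nonneg_part K.\<Gamma>)"
    using assms by (auto simp: fin_gen_semigroup_def)
  have "\<forall>e\<in>E. \<exists>x\<in>carrier L. \<omega> x = Fin e"
    using E by (auto simp: nonneg_part_def value_group_def)
  then obtain t where t: "\<And>e. e \<in> E \<Longrightarrow> t e \<in> carrier L" "\<And>e. e \<in> E \<Longrightarrow> \<omega> (t e) = Fin e"
    by metis
  obtain Us where U: "residue_independent Us" and max: "\<And>y. \<not> residue_independent (y # Us)"
    using maximal_residue_independent by blast
  have Us: "set Us \<subseteq> carrier L" "\<forall>u\<in>set Us. 0 \<le> \<omega> u"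
    using U by (auto simp: residue_independent_def)
  \<comment> \<open>The generators are the residue basis in degree 0 and one initial form for each
    semigroup generator \<open>e\<close>.\<close>
  define G where "G = homog 0 ` set Us \<union> (\<lambda>e. homog e (t e)) ` E"
  define H where "H = \<phi> ` carrier (gr LK \<nu>) \<union> G"
  let ?R = "generate_ring (gr L \<omega>) H"
  have tF: "t e \<in> Fge e" if "e \<in> E" for e
    using that t E by (auto simp: mem_Fge zero_extended_def nonneg_part_def)
  have G: "finite G" "G \<subseteq> carrier (gr L \<omega>)"
    using E Us tF by (auto simp: G_def mem_Fge zero_extended_def intro!: homog_closed)
  have HL: "H \<subseteq> carrier (gr L \<omega>)"
    using G incl_closed by (auto simp: H_def)
  have K_mem: "homog p z \<in> ?R" if "p \<in> K.\<Gamma>" "z \<in> K.Fge p" for p z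
    using incl_homog[OF that] K.homog_closed[OF that(2)] unfolding H_def
    by (intro generate_ring.incl UnI1) force
  \<comment> \<open>Such a form is zero, which is the image of the zero form of
    \<open>K\<close>.\<close>
  have zero_mem: "homog \<gamma> y \<in> ?R" if "y \<in> Fgt \<gamma>" for y \<gamma>
    using K_mem[of 0 \<zero>] K.value_group_closed(1) K_Fge K_zero_one that
    by (simp add: homog_eq_zero)
  \<comment> \<open>Modulo \<open>Fgt 0\<close>, an integral \<open>y\<close> is an integral
    combination of \<open>Us\<close> over \<open>K\<close>, and \<open>homog 0\<close> sees only
    this class.\<close>
  have unit_mem: "homog 0 y \<in> ?R" if y: "y \<in> carrier L" "0 \<le> \<omega> y" for y
  proof -
    obtain Ks where Ks: "length Ks = length Us" "set Ks \<subseteq> K" "\<And>k. k \<in> set Ks \<Longrightarrow> 0 \<le> \<omega> k"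
      and pos: "0 < \<omega> (y \<ominus> combine Ks Us)"
      using residue_spanning[OF U max y] by blast
    have c: "combine Ks Us \<in> carrier L"
      using Ks(2) Us(1) K_carrier by (intro combine_in_carrier) auto
    have k: "homog 0 k \<in> ?R" if "k \<in> K" "0 \<le> \<omega> k" for k
      using that K.value_group_closed(1) K_carrier
      by (intro K_mem) (auto simp: K_Fge mem_Fge zero_extended_def)
    have u: "homog 0 ` set Us \<subseteq> ?R"
      by (auto simp: H_def G_def intro: generate_ring.incl)
    have "homog 0 (combine Ks Us) \<in> ?R"
      by (rule conjunct2[OF homog_combine_mem[OF generate_ring.eng_add generate_ring.eng_mult k]])
        (simp_all add: Ks Us u)
    moreover have "y \<ominus> combine Ks Us \<in> Fgt 0"
      unfolding mem_Fgt using pos y c by (simp add: zero_extended_def less_imp_le)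
    ultimately show ?thesis
      using homog_cong[OF y(1) c] by simp
  qed
  have mem: "homog \<gamma> y \<in> ?R" if \<gamma>: "\<gamma> \<in> \<Gamma>" and y: "y \<in> Fge \<gamma>" for \<gamma> y
  proof (cases "y \<in> Fgt \<gamma>")
    case False
    then have "\<omega> y = Fin \<gamma>"
      using y by (auto simp: mem_Fge mem_Fgt order_le_less)
    then have yv: "y \<in> carrier L" "\<omega> y = Fin \<gamma>" "0 \<le> \<gamma>"
      using y by (simp_all add: mem_Fge zero_extended_def)
    then have "\<gamma> \<in> nonneg_part \<Gamma>"
      using \<gamma> by (simp add: nonneg_part_def)
    \<comment> \<open>The degree splits as e + p with p from the small value group. Accordingly
      \<open>y\<close> factors as \<open>t e\<close>, an element \<open>z\<close> of
      \<open>K\<close> of value p, and a factor \<open>w\<close> of value 0, so its form is a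
      product of three forms in the generated ring.\<close>
    then obtain e p where e: "e \<in> E" and p: "p \<in> nonneg_part K.\<Gamma>" and ep: "\<gamma> = e + p"
      using gen by auto
    then obtain z where z: "z \<in> K" "\<omega> z = Fin p" and p0: "0 \<le> p" "p \<in> K.\<Gamma>"
      using restriction by (auto simp: nonneg_part_def value_group_def)
    have zF: "z \<in> Fge p" "z \<in> K.Fge p"
      using z p0 K_carrier by (auto simp: K_Fge mem_Fge zero_extended_def)
    define s where "s = t e \<otimes> z"
    have s: "s \<in> carrier L" "\<omega> s = Fin \<gamma>"
      using t[OF e] z K_carrier by (auto simp: s_def val_mult ep)
    note i = val_inv[OF this]
    define w where "w = inv s \<otimes> y"
    have w: "w \<in> carrier L" "\<omega> w = 0"
      using i yv by (auto simp: w_def val_mult zero_extended_def)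
    have sw: "s \<otimes> w = y"
      using i s yv by (simp add: w_def m_assoc[symmetric])
    have eG: "e \<in> \<Gamma>" "p \<in> \<Gamma>"
      using e E p0 value_group_K by (auto simp: nonneg_part_def)
    have "homog e (t e) \<otimes>\<^bsub>gr L \<omega>\<^esub> homog p z = homog \<gamma> s"
      unfolding ep s_def using homog_mult[OF tF[OF e] zF(1) eG] .
    moreover have "homog \<gamma> s \<otimes>\<^bsub>gr L \<omega>\<^esub> homog 0 w = homog \<gamma> y"
    proof -
      have "s \<in> Fge \<gamma>" "w \<in> Fge 0"
        using s w yv by (simp_all add: mem_Fge zero_extended_def)
      then show ?thesis
        using homog_mult[of s \<gamma> w 0] \<gamma> value_group_closed(1) sw by simp
    qed
    moreover have "homog e (t e) \<in> ?R"
      using e by (auto simp: H_def G_def intro: generate_ring.incl)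
    moreover have "homog p z \<in> ?R"
      using K_mem p0 zF by blast
    moreover have "homog 0 w \<in> ?R"
      using unit_mem w by simp
    ultimately show ?thesis
      using generate_ring.eng_mult by metis
  qed (use zero_mem in blast)
  have "carrier (gr L \<omega>) \<subseteq> ?R"
  proof
    fix f assume "f \<in> carrier (gr L \<omega>)"
    then show "f \<in> ?R"
      by (rule gr_induct) (auto intro: mem generate_ring.eng_add)
  qed
  moreover have "?R \<subseteq> carrier (gr L \<omega>)"
    using generate_ring_gr_closed[OF HL] by blast
  ultimately show ?thesis
    unfolding fin_gen_algebra_def using G by (intro exI[of _ G]) (simp add: H_def)
qed

end

theorem theorem3p8:
  fixes L :: "('a, 'b) ring_scheme"
    and K :: "'a set"
    and \<omega> \<nu> :: "'a \<Rightarrow> 'g::linordered_ab_group_add extended"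
  assumes "field L"
    and "subfield K L"
    and "ring.finite_dimension L K (carrier L)"
    and "valuation L \<omega>"
    and "\<And>x. x \<in> K \<Longrightarrow> \<nu> x = \<omega> x"
  shows "fin_gen_algebra (gr_incl (L\<lparr>carrier := K\<rparr>) L \<nu> \<omega>) (gr (L\<lparr>carrier := K\<rparr>) \<nu>) (gr L \<omega>)
    \<longleftrightarrow> fin_gen_semigroup (nonneg_part (value_group L \<omega>))
          (nonneg_part (value_group (L\<lparr>carrier := K\<rparr>) \<nu>))"
proof -
  interpret valued_extension L \<omega> K \<nu>
    using assms by (intro valued_extension.intro valued_field.intro valued_field_axioms.intro
        valued_extension_axioms.intro)
  show ?thesis
    using fin_gen_semigroup_if_fin_gen_algebra fin_gen_algebra_if_fin_gen_semigroup by blast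
qed

end
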